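(* There exists an $O(n)$-time algorithm which, given a connected well-covered graph $G$ with $n$ vertices and girth at least $5$, and a vertex $v\in V(G)$, decides whether $v$ is shedding.
   Context: Graphs are finite, simple, undirected. The girth is the length of a shortest cycle (infinite if acyclic). $N(v)$ is the neighbourhood of $v$, $N[v]=N(v)\cup\{v\}$. A set is independent if its vertices are pairwise nonadjacent; maximal if not properly contained in another independent set. $\alpha(G)$ is the maximum size of an independent set; $G$ is well-covered if every maximal independent set has size $\alpha(G)$. A vertex $v$ is shedding if for every independent set $S\subseteq V(G)\setminus N[v]$ there exists $u\in N(v)$ such that $S\cup\{u\}$ is independent. *)

theory Defs
  imports
    "HOL-Library.Extended_Nat"
    "HOL-Library.Landau_Symbols"
    "Graph_Theory.Digraph_Component"
begin

section \<open>Graphs\<close>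

text \<open>
  A finite simple undirected graph is a \<^locale>\<open>pair_graph\<close>, i.e. a finite, symmetric, loop-free
  relation \<^const>\<open>parcs\<close> on \<^const>\<open>pverts\<close>: each edge is a pair of opposite arcs.
\<close>

definition nbh :: "'a pair_pre_digraph \<Rightarrow> 'a \<Rightarrow> 'a set" where
  "nbh G v = {u. (v, u) \<in> parcs G}"

definition closed_nbh :: "'a pair_pre_digraph \<Rightarrow> 'a \<Rightarrow> 'a set" where
  "closed_nbh G v = insert v (nbh G v)"

text \<open>
  Going back and forth along a single edge is a directed cycle of length 2; the cycles of the
  undirected graph are the directed cycles of length at least 3.  The infimum over the empty set
  is \<open>\<infinity>\<close>.
\<close>

definition girth :: "'a pair_pre_digraph \<Rightarrow> enat" where
  "girth G = (INF p \<in> {p. pre_digraph.cycle (with_proj G) p \<and> 3 \<le> length p}. enat (length p))"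

definition indep_set :: "'a pair_pre_digraph \<Rightarrow> 'a set \<Rightarrow> bool" where
  "indep_set G S \<longleftrightarrow> S \<subseteq> pverts G \<and> (\<forall>u\<in>S. \<forall>w\<in>S. (u, w) \<notin> parcs G)"

definition maximal_indep_set :: "'a pair_pre_digraph \<Rightarrow> 'a set \<Rightarrow> bool" where
  "maximal_indep_set G S \<longleftrightarrow> indep_set G S \<and> \<not> (\<exists>S'. indep_set G S' \<and> S \<subset> S')"

definition independence_number :: "'a pair_pre_digraph \<Rightarrow> nat" where
  "independence_number G = Max (card ` {S. indep_set G S})"

definition well_covered :: "'a pair_pre_digraph \<Rightarrow> bool" where
  "well_covered G \<longleftrightarrow> (\<forall>S. maximal_indep_set G S \<longrightarrow> card S = independence_number G)"

definition shedding :: "'a pair_pre_digraph \<Rightarrow> 'a \<Rightarrow> bool" where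
  "shedding G v \<longleftrightarrow>
     (\<forall>S. S \<subseteq> pverts G - closed_nbh G v \<and> indep_set G S \<longrightarrow>
          (\<exists>u \<in> nbh G v. indep_set G (S \<union> {u})))"

section \<open>Random access machines\<close>

text \<open>
  A uniform-cost RAM with a random-access read-only input and a work memory that is initially zero.
  There is no multiplication, and subtraction is truncated.  A program halts when its program
  counter leaves the program; the answer is then found in register 0.
\<close>

datatype instr =
    Const nat nat      \<comment> \<open>\<open>Const r k\<close>:   \<open>R\<^sub>r := k\<close>\<close>
  | Add nat nat nat    \<comment> \<open>\<open>Add r s t\<close>:   \<open>R\<^sub>r := R\<^sub>s + R\<^sub>t\<close>\<close>
  | Sub nat nat nat    \<comment> \<open>\<open>Sub r s t\<close>:   \<open>R\<^sub>r := R\<^sub>s - R\<^sub>t\<close>\<close>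
  | Input nat nat      \<comment> \<open>\<open>Input r s\<close>:   \<open>R\<^sub>r := input[R\<^sub>s]\<close>, or 0 beyond the end of the input\<close>
  | Load nat nat       \<comment> \<open>\<open>Load r s\<close>:    \<open>R\<^sub>r := memory[R\<^sub>s]\<close>\<close>
  | Store nat nat      \<comment> \<open>\<open>Store r s\<close>:   \<open>memory[R\<^sub>r] := R\<^sub>s\<close>\<close>
  | JumpZ nat nat      \<comment> \<open>\<open>JumpZ r l\<close>:   if \<open>R\<^sub>r = 0\<close> continue at instruction \<open>l\<close>\<close>

record config =
  pc :: nat
  regs :: "nat \<Rightarrow> nat"
  mem :: "nat \<Rightarrow> nat"

definition init_config :: config where
  "init_config = \<lparr> pc = 0, regs = (\<lambda>_. 0), mem = (\<lambda>_. 0) \<rparr>"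

definition set_reg :: "nat \<Rightarrow> nat \<Rightarrow> config \<Rightarrow> config" where
  "set_reg r x c = c\<lparr> pc := Suc (pc c), regs := (regs c)(r := x) \<rparr>"

fun exec :: "nat list \<Rightarrow> instr \<Rightarrow> config \<Rightarrow> config" where
  "exec inp (Const r k) c = set_reg r k c"
| "exec inp (Add r s t) c = set_reg r (regs c s + regs c t) c"
| "exec inp (Sub r s t) c = set_reg r (regs c s - regs c t) c"
| "exec inp (Input r s) c =
     set_reg r (if regs c s < length inp then inp ! regs c s else 0) c"
| "exec inp (Load r s) c = set_reg r (mem c (regs c s)) c"
| "exec inp (Store r s) c = c\<lparr> pc := Suc (pc c), mem := (mem c)(regs c r := regs c s) \<rparr>"
| "exec inp (JumpZ r l) c = c\<lparr> pc := (if regs c r = 0 then l else Suc (pc c)) \<rparr>"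

definition halted :: "instr list \<Rightarrow> config \<Rightarrow> bool" where
  "halted P c \<longleftrightarrow> length P \<le> pc c"

definition step :: "instr list \<Rightarrow> nat list \<Rightarrow> config \<Rightarrow> config" where
  "step P inp c = (if halted P c then c else exec inp (P ! pc c) c)"

definition run :: "instr list \<Rightarrow> nat list \<Rightarrow> nat \<Rightarrow> config" where
  "run P inp k = (step P inp ^^ k) init_config"

text \<open>
  The bound \<open>w\<close> on all numbers ever stored is what makes uniform cost realistic: with \<open>w\<close>
  polynomial in the size of the instance, machine words have logarithmically many bits.
\<close>

definition decides_within :: "instr list \<Rightarrow> nat list \<Rightarrow> bool \<Rightarrow> nat \<Rightarrow> nat \<Rightarrow> bool" where
  "decides_within P inp b t w \<longleftrightarrow>
     (\<exists>k\<le>t. halted P (run P inp k) \<and> regs (run P inp k) 0 = (if b then 1 else 0)) \<and>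
     (\<forall>k i. regs (run P inp k) i \<le> w \<and> mem (run P inp k) i \<le> w)"

section \<open>Input encoding\<close>

definition adjacency_lists :: "nat pair_pre_digraph \<Rightarrow> nat list list \<Rightarrow> bool" where
  "adjacency_lists G L \<longleftrightarrow>
     pverts G = {..<length L} \<and> (\<forall>u<length L. distinct (L ! u) \<and> set (L ! u) = nbh G u)"

text \<open>
  The input word is \<open>n\<close>, \<open>v\<close>, then \<open>n + 1\<close> addresses, then all adjacency lists one after the
  other.  The list of \<open>u\<close> occupies the cells from the \<open>u\<close>-th address (inclusive) to the
  \<open>(u + 1)\<close>-st address (exclusive); addresses are indices into the input word itself.
\<close>

definition encode_input :: "nat list list \<Rightarrow> nat \<Rightarrow> nat list" where
  "encode_input L v =
     (let n = length L in
      [n, v] @ map (\<lambda>u. n + 3 + (\<Sum>w<u. length (L ! w))) [0..<n + 1] @ concat L)"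

end

theory Submission
  imports Defs
begin

text \<open>
  Let \<open>A(u) = N(u) - {v}\<close> for the neighbours \<open>u\<close> of \<open>v\<close>.  In a well-covered graph without
  triangles, an independent set that avoids the closed neighbourhood of \<open>v\<close> dominates at most one
  set \<open>A(u)\<close>.  With girth at least 5 this forces a shedding vertex \<open>v\<close> to have a leaf as a neighbour
  or to lie on a pentagon \<open>v u x y u'\<close> in which \<open>u\<close> and \<open>u'\<close> have degree 2.  The proof is by induction
  on the graph: for a vertex \<open>w\<close> that is not adjacent to \<open>v\<close>, deleting the closed neighbourhood of \<open>w\<close>
  preserves all hypotheses, so the conclusion holds there; in the original graph it says that \<open>w\<close>
  has a neighbour in some \<open>A(u)\<close> with at most 2 elements.  Moreover \<open>x\<close> or \<open>y\<close> has degree 2, since otherwise two outer neighbours of \<open>x\<close>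
  and \<open>y\<close> would dominate both \<open>A(u)\<close> and \<open>A(u')\<close>.

  Therefore \<open>v\<close> is shedding iff some neighbour is a leaf, or there is a path \<open>v u x y\<close> with \<open>u\<close> and
  \<open>x\<close> of degree 2 such that \<open>y\<close> is also the second neighbour of a neighbour of \<open>v\<close> of degree 2.
  This takes constant time for each neighbour of \<open>v\<close>, although the number of edges
  need not be linear in the number of vertices.
\<close>

section \<open>Shedding vertices of well-covered graphs of girth at least 5\<close>

locale girth5_graph =
  fixes E :: "'a \<Rightarrow> 'a \<Rightarrow> bool"
  assumes sym: "E x y \<Longrightarrow> E y x"
    and irrefl: "\<not> E x x"
    and no_triangle: "E x y \<Longrightarrow> E y z \<Longrightarrow> \<not> E x z"
    and no_square: "E a x \<Longrightarrow> E x b \<Longrightarrow> E b y \<Longrightarrow> E y a \<Longrightarrow> a = b \<or> x = y"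
begin

definition indep :: "'a set \<Rightarrow> bool" where
  "indep S \<longleftrightarrow> (\<forall>x\<in>S. \<forall>y\<in>S. \<not> E x y)"

definition maxind :: "'a set \<Rightarrow> 'a set \<Rightarrow> bool" where
  "maxind V S \<longleftrightarrow> S \<subseteq> V \<and> indep S \<and> (\<forall>x\<in>V - S. \<exists>y\<in>S. E x y)"

definition wc :: "'a set \<Rightarrow> bool" where
  "wc V \<longleftrightarrow> (\<forall>S T. maxind V S \<longrightarrow> maxind V T \<longrightarrow> card S = card T)"

text \<open>
  Everything is relative to a vertex set \<open>V\<close>, which stands for the subgraph that it induces.
  That \<open>insert v S\<close> is independent says that \<open>S\<close> avoids the closed neighbourhood of \<open>v\<close>.
\<close>

definition shed :: "'a set \<Rightarrow> 'a \<Rightarrow> bool" where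
  "shed V v \<longleftrightarrow> (\<forall>S. S \<subseteq> V \<and> v \<notin> S \<and> indep (insert v S) \<longrightarrow>
     (\<exists>u\<in>V. E v u \<and> indep (insert u S)))"

definition leaf_or_pentagon :: "'a set \<Rightarrow> 'a \<Rightarrow> bool" where
  "leaf_or_pentagon V v \<longleftrightarrow>
     (\<exists>u\<in>V. E v u \<and> (\<forall>z\<in>V. E u z \<longrightarrow> z = v)) \<or>
     (\<exists>u\<in>V. \<exists>u'\<in>V. \<exists>x\<in>V. \<exists>y\<in>V. E v u \<and> E v u' \<and> E u x \<and> E u' y \<and> E x y \<and> x \<noteq> v \<and> y \<noteq> v \<and>
        (\<forall>z\<in>V. E u z \<longrightarrow> z = v \<or> z = x) \<and> (\<forall>z\<in>V. E u' z \<longrightarrow> z = v \<or> z = y))"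

section \<open>Maximal independent sets and deletion of closed neighbourhoods\<close>

lemma indep_empty [simp]: "indep {}"
  by (simp add: indep_def)

lemma indep_insert [simp]: "indep (insert x S) \<longleftrightarrow> indep S \<and> (\<forall>y\<in>S. \<not> E x y)"
  unfolding indep_def using sym irrefl by blast

lemma maxind_extend:
  assumes "finite V" "S \<subseteq> V" "indep S"
  obtains T where "maxind V T" "S \<subseteq> T"
proof -
  let ?F = "{T. S \<subseteq> T \<and> T \<subseteq> V \<and> indep T}"
  have "finite ?F" by (rule finite_subset[of _ "Pow V"]) (use assms in auto)
  moreover have "S \<in> ?F" using assms by simp
  ultimately obtain T where "T \<in> ?F" "S \<subseteq> T" "\<forall>T'\<in>?F. T \<subseteq> T' \<longrightarrow> T = T'"
    by (rule finite_has_maximal2[THEN bexE]) (erule conjE)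
  then have T: "S \<subseteq> T" "T \<subseteq> V" "indep T"
    and "\<And>T'. S \<subseteq> T' \<Longrightarrow> T' \<subseteq> V \<Longrightarrow> indep T' \<Longrightarrow> T \<subseteq> T' \<Longrightarrow> T = T'" by simp_all
  then have max: "x \<in> T" if "x \<in> V" "indep (insert x T)" for x
    using that by (metis insert_subset subset_insertI subset_trans)
  have "\<exists>y\<in>T. E x y" if "x \<in> V - T" for x
    using T(3) max[of x] that by auto
  then show thesis using that[of T] T(1-3) by (auto simp: maxind_def)
qed

text \<open>An extension of \<open>S\<close> to a maximal set has the size of \<open>T\<close>,
  hence of \<open>S\<close>, so it adds nothing. Exchange arguments thus obtain maximality from a
  count.\<close>

lemma wc_maxindI:
  assumes "finite V" "wc V" "maxind V T" "S \<subseteq> V" "indep S" "card S = card T"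
  shows "maxind V S"
proof -
  obtain S' where S': "maxind V S'" "S \<subseteq> S'" using maxind_extend[OF assms(1,4,5)] .
  then have "card S' = card S" using assms unfolding wc_def by metis
  moreover have "finite S'" using S' assms(1) by (auto simp: maxind_def intro: finite_subset)
  ultimately have "S = S'" using S'(2) by (simp add: card_subset_eq)
  then show ?thesis using S' by simp
qed

text \<open>Adding \<open>w\<close> to a maximal independent set of the smaller graph gives one of
  \<open>V\<close> with one more vertex.\<close>

lemma wc_delete:
  assumes "finite V" "wc V" "w \<in> V"
  shows "wc (V - {x. x = w \<or> E w x})"
proof -
  have *: "maxind V (insert w S) \<and> card (insert w S) = Suc (card S)"
    if S: "maxind (V - {x. x = w \<or> E w x}) S" for S
  proof
    show "maxind V (insert w S)" using S assms(3) sym by (auto simp: maxind_def)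
    have "finite S" "w \<notin> S" using S assms(1) by (auto simp: maxind_def intro: finite_subset)
    then show "card (insert w S) = Suc (card S)" by simp
  qed
  then show ?thesis using assms(2) unfolding wc_def by (metis nat.inject)
qed

text \<open>Shedding is applied to \<open>insert w S\<close>; the \<open>u\<close> obtained is
  nonadjacent to \<open>w\<close>, so it survives the deletion.\<close>

lemma shed_delete:
  assumes "shed V v" "w \<in> V" "w \<noteq> v" "\<not> E v w"
  shows "shed (V - {x. x = w \<or> E w x}) v"
  unfolding shed_def
proof (intro allI impI)
  fix S assume S: "S \<subseteq> V - {x. x = w \<or> E w x} \<and> v \<notin> S \<and> indep (insert v S)"
  have "\<exists>u\<in>V. E v u \<and> indep (insert u (insert w S))"
  proof -
    have "insert w S \<subseteq> V" "v \<notin> insert w S" "indep (insert v (insert w S))"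
      using assms(2-4) S sym by auto
    then show ?thesis using assms(1) unfolding shed_def by blast
  qed
  then obtain u where "u \<in> V" "E v u" "indep (insert u (insert w S))" by blast
  then show "\<exists>u\<in>V - {x. x = w \<or> E w x}. E v u \<and> indep (insert u S)"
    using assms(4) sym by (intro bexI[of _ u]) auto
qed

section \<open>Domination of the sets \<open>A(u)\<close>\<close>

definition dominates :: "'a set \<Rightarrow> 'a \<Rightarrow> 'a set \<Rightarrow> 'a \<Rightarrow> bool" where
  "dominates V v I u \<longleftrightarrow> (\<forall>z\<in>V. E u z \<longrightarrow> z = v \<or> (\<exists>s\<in>I. E z s))"

text \<open>Let \<open>T\<close> be a maximal independent set containing \<open>v\<close> and
  \<open>I\<close>. Replacing \<open>v\<close> by all its neighbours without neighbours in the rest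
  of \<open>T\<close> gives another maximal independent set, as there are no triangles. Equal sizes
  leave exactly one such neighbour, and every \<open>u\<close> whose \<open>A(u)\<close> is
  dominated is one.\<close>

lemma dominates_one:
  assumes V: "finite V" "wc V" "v \<in> V"
    and I: "I \<subseteq> V" "indep I" "\<forall>s\<in>I. s \<noteq> v \<and> \<not> E v s"
    and u: "u \<in> V" "E v u" "dominates V v I u"
    and u': "u' \<in> V" "E v u'" "dominates V v I u'"
  shows "u = u'"
proof -
  obtain T where T: "maxind V T" "insert v I \<subseteq> T"
    using maxind_extend[of V "insert v I"] V I by auto
  define J where "J = T - {v}"
  define U where "U = {z\<in>V. E v z \<and> (\<forall>s\<in>J. \<not> E z s)}"
  have T_eq: "T = insert v J" "v \<notin> J" using T by (auto simp: J_def)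
  have fin: "finite J" "finite U"
    using V(1) T(1) by (auto simp: J_def U_def maxind_def intro: finite_subset)
  have J: "J \<subseteq> V" "indep J" "\<And>s. s \<in> J \<Longrightarrow> \<not> E v s"
    using T T_eq by (auto simp: maxind_def)
  have dom: "z \<in> U" if z: "z \<in> V" "E v z" "dominates V v I z" for z
  proof -
    have "\<not> E z s" if "s \<in> J" for s
    proof
      assume "E z s"
      then obtain t where "t \<in> I" "E s t"
        using \<open>s \<in> J\<close> J(1) T_eq(2) z(3) unfolding dominates_def by blast
      then show False using T T_eq \<open>s \<in> J\<close> by (auto simp: maxind_def indep_def)
    qed
    then show ?thesis using z by (auto simp: U_def)
  qed
  have uU: "u \<in> U" "u' \<in> U" using dom u u' by blast+
  have "maxind V (J \<union> U)"
    unfolding maxind_def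
  proof (intro conjI ballI)
    show "J \<union> U \<subseteq> V" using J by (auto simp: U_def)
    show "indep (J \<union> U)"
      unfolding indep_def
    proof (intro ballI notI)
      fix p q assume "p \<in> J \<union> U" "q \<in> J \<union> U" "E p q"
      moreover have "\<not> (E v p \<and> E v q)" using \<open>E p q\<close> no_triangle[of v p q] by blast
      ultimately show False using J(2) sym[of p q] by (auto simp: U_def indep_def)
    qed
    fix x assume x: "x \<in> V - (J \<union> U)"
    show "\<exists>y\<in>J \<union> U. E x y"
    proof (cases "x = v \<or> E v x")
      case True
      then show ?thesis using uU x by (auto simp: U_def)
    next
      case False
      then have "x \<in> V - T" using x T_eq by blast
      then obtain y where "y \<in> T" "E x y" using T(1) unfolding maxind_def by blast
      moreover from this have "y \<noteq> v" using False sym by blast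
      ultimately show ?thesis using T_eq by blast
    qed
  qed
  then have "card (J \<union> U) = card T" using V T(1) unfolding wc_def by blast
  moreover have "J \<inter> U = {}" using J(3) by (auto simp: U_def)
  ultimately have "card U = 1" using fin T_eq by (simp add: card_Un_disjoint)
  then show ?thesis using uU by (metis card_1_singletonE singletonD)
qed

section \<open>Excluding singletons \<open>A(u)\<close> in a minimal counterexample\<close>

text \<open>The induction hypothesis is used for \<open>w = a\<close>. A leaf that appears after the
  deletion closes a pentagon with \<open>u1\<close> and \<open>a\<close>. A pentagon leads to
  \<open>A(u2) = {b, b'}\<close> and \<open>A(u3) = {c, c'}\<close> with \<open>a\<close> adjacent
  to \<open>b\<close> and \<open>c\<close>, which domination and one exchange exclude. Any neighbour
  of \<open>a\<close> dominates \<open>A(u1) = {a}\<close>, so \<open>u1\<close> is often one of two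
  dominated vertices.\<close>

lemma no_singleton:
  assumes V: "finite V" "wc V" "v \<in> V"
    and neg: "\<not> leaf_or_pentagon V v"
    and IH: "\<And>w. w \<in> V \<Longrightarrow> w \<noteq> v \<Longrightarrow> \<not> E v w \<Longrightarrow> leaf_or_pentagon (V - {x. x = w \<or> E w x}) v"
    and u1: "u1 \<in> V" "E v u1"
    and a: "a \<in> V" "E u1 a" "a \<noteq> v"
    and single: "\<And>z. z \<in> V \<Longrightarrow> E u1 z \<Longrightarrow> z = v \<or> z = a"
  shows False
proof -
  have va: "\<not> E v a" using no_triangle u1 a by blast
  have u1_neq: "u \<noteq> u1" if "\<not> E a u" for u using that a(2) sym by blast
  have dom_u1: "dominates V v I u1" if "s \<in> I" "E a s" for I s
    using single that unfolding dominates_def by blast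
  note dominates_one = dominates_one[OF V]
  have "\<not> (\<exists>u\<in>V - {x. x = a \<or> E a x}. E v u \<and> (\<forall>z\<in>V - {x. x = a \<or> E a x}. E u z \<longrightarrow> z = v))"
  proof
    assume "\<exists>u\<in>V - {x. x = a \<or> E a x}. E v u \<and> (\<forall>z\<in>V - {x. x = a \<or> E a x}. E u z \<longrightarrow> z = v)"
    then obtain u where u: "u \<in> V" "E v u" "\<not> E a u" "u \<noteq> a"
      and uz: "\<And>z. z \<in> V \<Longrightarrow> E u z \<Longrightarrow> z = v \<or> E a z" using sym by blast
    obtain b where b: "b \<in> V" "E u b" "b \<noteq> v"
      using neg u unfolding leaf_or_pentagon_def by blast
    then have ab: "E a b" using uz by blast
    \<comment> \<open>Two vertices of \<open>A(u)\<close> adjacent to \<open>a\<close> would form a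
      square with \<open>u\<close> and \<open>a\<close>; hence \<open>A(u) = {b}\<close>, and
      \<open>v u b a u1\<close> is a pentagon.\<close>
    have "z = v \<or> z = b" if "z \<in> V" "E u z" for z
      using no_square[of u z a b] uz[OF that] that ab b u(4) sym by blast
    then have "leaf_or_pentagon V v"
      unfolding leaf_or_pentagon_def using u(1,2) u1 a b ab single by blast
    then show False using neg by blast
  qed
  moreover define V' where "V' = V - {x. x = a \<or> E a x}"
  ultimately obtain u2 u3 b' c' where in_V': "u2 \<in> V'" "u3 \<in> V'" "b' \<in> V'" "c' \<in> V'"
    and u2: "E v u2" "E u2 b'" "b' \<noteq> v" and u3: "E v u3" "E u3 c'" "c' \<noteq> v" and bc: "E b' c'"
    and Nu2: "\<forall>z\<in>V'. E u2 z \<longrightarrow> z = v \<or> z = b'" and Nu3: "\<forall>z\<in>V'. E u3 z \<longrightarrow> z = v \<or> z = c'"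
    using IH[OF a(1,3) va] unfolding leaf_or_pentagon_def by blast
  have V23: "u2 \<in> V" "u3 \<in> V" "b' \<in> V" "c' \<in> V"
    and nadj: "\<not> E a u2" "\<not> E a u3" "\<not> E a b'" "b' \<noteq> a" "\<not> E a c'" "c' \<noteq> a"
    using in_V' by (auto simp: V'_def)
  have A2: "z = v \<or> z = b' \<or> E a z" if "z \<in> V" "E u2 z" for z
    using Nu2 that nadj(1) sym[of u2 a] by (auto simp: V'_def)
  have A3: "z = v \<or> z = c' \<or> E a z" if "z \<in> V" "E u3 z" for z
    using Nu3 that nadj(2) sym[of u3 a] by (auto simp: V'_def)
  have neqa: "u2 \<noteq> a" "u3 \<noteq> a" using u2(1) u3(1) va by blast+
  have far: "\<not> E v b'" "\<not> E v c'" using no_triangle u2(1,2) u3(1,2) by blast+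
  have u23: "u2 \<noteq> u3" using no_triangle u2(2) u3(2) bc by blast
  \<comment> \<open>If \<open>A(p) = {s}\<close> and \<open>A(q) = {t, t'}\<close>, then \<open>A(q)\<close> dominates both \<open>A(p)\<close> and \<open>A(u1)\<close>.\<close>
  have no_one: False
    if "p \<in> V" "q \<in> V" "E v p" "E v q" "p \<noteq> a" "q \<noteq> a" "\<not> E a p" "\<not> E a q" "s \<in> V" "t \<in> V" "E p s" "E q t" "E s t"
      "t \<noteq> v" "s \<noteq> v" "t' \<in> V" "E q t'" "E a t'" "t' \<noteq> v"
      and p: "\<And>z. z \<in> V \<Longrightarrow> E p z \<Longrightarrow> z = v \<or> z = s" for p q s t t'
  proof -
    have "\<not> E t t'" "\<not> E v t" "\<not> E v t'" using no_triangle that(4,12,17) by blast+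
    moreover have "dominates V v {t, t'} p" using p \<open>E s t\<close> unfolding dominates_def by blast
    ultimately have "u1 = p"
      using that(1,3,9,10,14,16,18,19) u1
      by (intro dominates_one[of "{t, t'}"] dom_u1[of t']) auto
    then show False using that(7) u1_neq by blast
  qed
  obtain b where b: "b \<in> V" "E u2 b" "E a b" "b \<noteq> v"
  proof -
    have "\<exists>b\<in>V. E u2 b \<and> E a b \<and> b \<noteq> v"
    proof (rule ccontr)
      assume no_b: "\<not> ?thesis"
      have s2: "z = v \<or> z = b'" if "z \<in> V" "E u2 z" for z using A2 that no_b by blast
      have "\<exists>c\<in>V. E u3 c \<and> E a c \<and> c \<noteq> v"
      proof (rule ccontr)
        assume no_c: "\<not> ?thesis"
        have s3: "z = v \<or> z = c'" if "z \<in> V" "E u3 z" for z using A3 that no_c by blast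
        then have "leaf_or_pentagon V v"
          unfolding leaf_or_pentagon_def using V23 u2(1-3) u3(1-3) bc s2 by blast
        then show False using neg by blast
      qed
      then show False using no_one[of u2 u3 b' c'] V23 u2 u3 nadj bc s2 neqa by blast
    qed
    then show thesis using that by blast
  qed
  obtain c where c: "c \<in> V" "E u3 c" "E a c" "c \<noteq> v"
  proof -
    have "\<exists>c\<in>V. E u3 c \<and> E a c \<and> c \<noteq> v"
    proof (rule ccontr)
      assume no_c: "\<not> ?thesis"
      have s3: "z = v \<or> z = c'" if "z \<in> V" "E u3 z" for z using A3 that no_c by blast
      then show False using no_one[of u3 u2 c' b'] V23 u2 u3 nadj bc b s3 neqa sym by blast
    qed
    then show thesis using that by blast
  qed
  have far2: "\<not> E v b" "\<not> E v c" using no_triangle u2(1) u3(1) b c by blast+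
  have Nb: "z = v \<or> z = b \<or> z = b'" if "z \<in> V" "E u2 z" for z
    using A2[OF that] no_square[of u2 z a b] that b neqa sym by blast
  have Nc: "z = v \<or> z = c \<or> z = c'" if "z \<in> V" "E u3 z" for z
    using A3[OF that] no_square[of u3 z a c] that c neqa sym by blast
  \<comment> \<open>Here \<open>A(p)\<close> is contained in \<open>{s, s'}\<close>, and
    \<open>c'\<close> is \<open>t'\<close>. If \<open>q\<close> were not adjacent to
    \<open>t'\<close>, the independent set \<open>{t, t', q}\<close> would dominate both
    \<open>A(p)\<close> and \<open>A(u1)\<close>.\<close>
  have core: "E c' q"
    if "p \<in> V" "r \<in> V" "E v p" "E v r" "\<not> E a p"
      "E p s'" "E r t'" "E s' t'" "E p s" "E a s" "E r t" "E a t" "p \<noteq> r"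
      "t \<in> V" "t' \<in> V" "t \<noteq> v" "t' \<noteq> v" "q \<in> V" "E s q" "q \<noteq> p" "q \<noteq> a" "t' = c'"
      "s \<noteq> v"
      and p: "\<And>z. z \<in> V \<Longrightarrow> E p z \<Longrightarrow> z = v \<or> z = s \<or> z = s'" for p r s s' t t' q c'
  proof (rule ccontr)
    assume n: "\<not> E c' q"
    have far: "\<not> E v t" "\<not> E v t'" "\<not> E v s" using no_triangle that(3,4,7,9,11) by blast+
    have tt': "\<not> E t t'" using no_triangle that(7,11) by blast
    have "s \<noteq> t"
      using no_square[of v p s r] that(3,4,9,11,13,23) sym by metis
    then have "\<not> E q t"
      using no_square[of s q t a] that(10,12,19,21) sym by metis
    moreover have "\<not> E v q"
      using no_square[of v p s q] that(3,9,19,20,23) sym by metis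
    moreover have "q \<noteq> v" using far(3) that(19) sym by metis
    moreover have "dominates V v {t, t', q} p"
      using p that(8,19) sym unfolding dominates_def by blast
    moreover have "\<not> E t' q" using n \<open>t' = c'\<close> by simp
    moreover have "\<not> E q t'" using \<open>\<not> E t' q\<close> sym by blast
    ultimately have "u1 = p"
      using that(1,3,12,14-18) far u1 tt'
      by (intro dominates_one[of "{t, t', q}"] dom_u1[of t]) (auto dest: sym)
    then show False using that(5) u1_neq by blast
  qed
  have deg_b: "E c' q" if "q \<in> V" "E b q" "q \<noteq> u2" "q \<noteq> a" for q
    by (rule core[of u2 u3 b' c' b c q]) (use that V23 u2 u3 nadj b c bc u23 Nb in auto)
  have deg_c: "E b' q" if "q \<in> V" "E c q" "q \<noteq> u3" "q \<noteq> a" for q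
    by (rule core[of u3 u2 c' b' c b q]) (use that V23 u2 u3 nadj b c sym[OF bc] u23 Nc in auto)
  \<comment> \<open>A maximal independent set containing \<open>v\<close>, \<open>a\<close> and \<open>s'\<close> stays independent if \<open>a\<close> is replaced
      by \<open>s\<close> and \<open>s'\<close> by \<open>t'\<close>, but then \<open>t\<close> can be added to it.\<close>
  have key: False
    if "p \<in> V" "r \<in> V" "E v p" "E v r" "p \<noteq> r" "E p s" "E p s'" "E r t" "E r t'"
      "s \<in> V" "s' \<in> V" "t \<in> V" "t' \<in> V" "s \<noteq> v" "s' \<noteq> v" "t \<noteq> v" "t' \<noteq> v"
      "E a s" "E a t" "E s' t'" "\<not> E a s'" "s' \<noteq> a" "\<not> E a t'" "t' \<noteq> a"
      and ds: "\<And>q. q \<in> V \<Longrightarrow> E s q \<Longrightarrow> q \<noteq> p \<Longrightarrow> q \<noteq> a \<Longrightarrow> E t' q"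
      and dt: "\<And>q. q \<in> V \<Longrightarrow> E t q \<Longrightarrow> q \<noteq> r \<Longrightarrow> q \<noteq> a \<Longrightarrow> E s' q"
      and dt': "\<And>q. q \<in> V \<Longrightarrow> E t' q \<Longrightarrow> q \<noteq> r \<Longrightarrow> q \<noteq> s' \<Longrightarrow> E a q"
    for p r s s' t t'
  proof -
    have far: "\<not> E v s" "\<not> E v s'" "\<not> E v t" "\<not> E v t'" using that(3,4,6-9) no_triangle by blast+
    have ss: "\<not> E s s'" "\<not> E t t'" using that(6-9) no_triangle by blast+
    have st: "\<not> E s t" using that(18,19) no_triangle by blast
    have st': "\<not> E s t'" using no_square[of s t' s' p] that(3,6,7,18,20,21) far(4) sym by metis
    \<comment> \<open>A further neighbour \<open>q\<close> of \<open>s\<close> would be adjacent to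
      \<open>t'\<close> by \<open>ds\<close>, hence to \<open>a\<close> by \<open>dt'\<close>, and
      \<open>a s q\<close> would be a triangle.\<close>
    have ds': "q = p \<or> q = a" if "q \<in> V" "E s q" for q
    proof (rule ccontr)
      assume q: "\<not> ?thesis"
      have "q \<noteq> r"
        using no_square[of v p s r] \<open>E v p\<close> \<open>E p s\<close> \<open>E s q\<close> \<open>E v r\<close> \<open>p \<noteq> r\<close> \<open>s \<noteq> v\<close> sym by metis
      moreover have "q \<noteq> s'" using ss \<open>E s q\<close> by blast
      ultimately have "E a q" using ds dt' q \<open>q \<in> V\<close> \<open>E s q\<close> by blast
      then show False using no_triangle \<open>E a s\<close> \<open>E s q\<close> by blast
    qed
    have "indep {v, a, s'}" using that(21) va far by (auto dest: sym)
    then obtain T where T: "maxind V T" "{v, a, s'} \<subseteq> T"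
      using maxind_extend[OF V(1), of "{v, a, s'}"] V(3) a(1) \<open>s' \<in> V\<close> by auto
    have finT: "finite T" using T V(1) by (auto simp: maxind_def intro: finite_subset)
    have TV: "T \<subseteq> V" and Tind: "\<And>x y. x \<in> T \<Longrightarrow> y \<in> T \<Longrightarrow> \<not> E x y"
      using T(1) by (auto simp: maxind_def indep_def)
    have Ta: "\<not> E a x" "\<not> E v x" "\<not> E s' x" if "x \<in> T" for x using Tind T(2) that by auto
    have notT: "s \<notin> T" "t \<notin> T" "t' \<notin> T" "p \<notin> T" "r \<notin> T"
      using Ta that(3,4,18-20) by blast+
    have t'x: "\<not> E t' x" if "x \<in> T" "x \<noteq> s'" for x
      using dt' TV that notT Ta by blast
    have sx: "\<not> E s x" if "x \<in> T" "x \<noteq> a" for x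
      using ds' TV that notT by blast
    define T' where "T' = insert s (insert t' (T - {a, s'}))"
    have "maxind V T'"
    proof (rule wc_maxindI[OF V(1,2) T(1)])
      show "T' \<subseteq> V" using TV that by (auto simp: T'_def)
      have "indep (T - {a, s'})" using Tind by (auto simp: indep_def)
      then show "indep T'" using t'x sx st' by (auto simp: T'_def)
      have "s \<noteq> t'" using that(18,23) by blast
      moreover have "card T = card (T - {a, s'}) + card {a, s'}"
        using finT T(2) by (metis card_Diff_subset card_mono finite.emptyI finite_insert insert_subset le_add_diff_inverse2)
      ultimately show "card T' = card T"
        using finT notT \<open>s' \<noteq> a\<close> by (simp add: T'_def)
    qed
    moreover have "t \<noteq> s" using no_square[of v p s r] that(3-6,8,14) sym by metis
    then have "t \<notin> T'" using notT \<open>E a t\<close> \<open>\<not> E a t'\<close> by (auto simp: T'_def)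
    ultimately obtain q where q: "q \<in> T'" "E t q" using \<open>t \<in> V\<close> unfolding maxind_def by blast
    then have "q \<in> T" "q \<noteq> a" "q \<noteq> s'" using st ss sym by (auto simp: T'_def)
    then show False using dt[of q] q(2) TV Ta notT by blast
  qed
  \<comment> \<open>Otherwise there are outer neighbours \<open>p\<close> of \<open>b'\<close> and
    \<open>q\<close> of \<open>c'\<close>, both nonadjacent to \<open>a\<close>, and
    \<open>{a, p, q}\<close> dominates \<open>A(u2)\<close> and \<open>A(u3)\<close>. Each
    alternative supplies \<open>dt'\<close> of \<open>key\<close> for one orientation of the
    pentagon.\<close>
  have "(\<forall>q\<in>V. E c' q \<longrightarrow> q \<noteq> u3 \<longrightarrow> q \<noteq> b' \<longrightarrow> E a q) \<or>
        (\<forall>q\<in>V. E b' q \<longrightarrow> q \<noteq> u2 \<longrightarrow> q \<noteq> c' \<longrightarrow> E a q)"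
  proof (rule ccontr)
    assume "\<not> ?thesis"
    then obtain p q where p: "p \<in> V" "E b' p" "p \<noteq> u2" "p \<noteq> c'" "\<not> E a p"
      and q: "q \<in> V" "E c' q" "q \<noteq> u3" "q \<noteq> b'" "\<not> E a q" by blast
    have "\<not> E p q" using no_square[of p b' c' q] p q bc sym by metis
    moreover have "\<not> E v p" "\<not> E v q"
      using no_square[of v u2 b' p] no_square[of v u3 c' q] p q u2 u3 sym by metis+
    moreover have "p \<noteq> v" "q \<noteq> v" using p q far sym by metis+
    moreover have "dominates V v {a, p, q} u2"
      using Nb b(3) p(2) sym unfolding dominates_def by blast
    moreover have "dominates V v {a, p, q} u3"
      using Nc c(3) q(2) sym unfolding dominates_def by blast
    ultimately have "u2 = u3"
      using p q V23 u2(1) u3(1) a(1,3) va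
      by (intro dominates_one[of "{a, p, q}"]) (auto dest: sym)
    then show False using u23 by blast
  qed
  then show False
  proof
    assume "\<forall>q\<in>V. E c' q \<longrightarrow> q \<noteq> u3 \<longrightarrow> q \<noteq> b' \<longrightarrow> E a q"
    then show False
      using key[of u2 u3 b b' c c'] V23 u2 u3 nadj b c u23 bc deg_b deg_c by blast
  next
    assume "\<forall>q\<in>V. E b' q \<longrightarrow> q \<noteq> u2 \<longrightarrow> q \<noteq> c' \<longrightarrow> E a q"
    then show False
      using key[of u3 u2 c c' b b'] V23 u2 u3 nadj b c u23 sym[OF bc] deg_b deg_c by blast
  qed
qed

section \<open>Sets \<open>A(u)\<close> with two vertices, one of them adjacent to
  \<open>w\<close>\<close>

text \<open>Deleting \<open>x'\<close>, a neighbour of \<open>w\<close>, leaves \<open>x\<close> as the only vertex of \<open>A(u)\<close>.\<close>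

definition fork :: "'a set \<Rightarrow> 'a \<Rightarrow> 'a \<Rightarrow> 'a \<Rightarrow> 'a \<Rightarrow> 'a \<Rightarrow> bool" where
  "fork V v w u x x' \<longleftrightarrow> u \<in> V \<and> x \<in> V \<and> x' \<in> V \<and> E v u \<and> E u x \<and> E u x' \<and> x \<noteq> v \<and> x' \<noteq> v \<and> x \<noteq> x' \<and>
     E w x' \<and> (\<forall>z\<in>V. E u z \<longrightarrow> z = v \<or> z = x \<or> z = x')"

text \<open>The vertices of \<open>A(u)\<close> other than \<open>x\<close> are neighbours of
  \<open>w\<close>, and two of them would form a square with \<open>u\<close> and
  \<open>w\<close>.\<close>

lemma forkI:
  assumes u: "u \<in> V" "E v u" "\<not> E w u" "u \<noteq> w" and x: "x \<in> V" "E u x" "x \<noteq> v" "\<not> E w x"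
    and N: "\<And>z. z \<in> V \<Longrightarrow> E u z \<Longrightarrow> z = v \<or> z = x \<or> E w z"
    and ns: "\<exists>z\<in>V. E u z \<and> z \<noteq> v \<and> z \<noteq> x"
  obtains x' where "fork V v w u x x'"
proof -
  obtain x' where x': "x' \<in> V" "E u x'" "x' \<noteq> v" "x' \<noteq> x" "E w x'" using ns N by blast
  have "z = x'" if "z \<in> V" "E u z" "z \<noteq> v" "z \<noteq> x" for z
    using no_square[of u z w x'] N[OF that(1,2)] that x' u(4) sym by metis
  then have "fork V v w u x x'" unfolding fork_def using u x x' by blast
  then show thesis by (rule that)
qed

text \<open>If \<open>u\<close> survives the deletion, \<open>A(u)\<close> loses at most one vertex,
  for otherwise a square arises. As \<open>A(u)\<close> has at least two vertices, no leaf appears.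
  So there is a pentagon, and \<open>A(u)\<close> and \<open>A(u')\<close> have lost one vertex
  each.\<close>

lemma fork_pair:
  assumes neg: "\<And>u a. u \<in> V \<Longrightarrow> E v u \<Longrightarrow> a \<in> V \<Longrightarrow> E u a \<Longrightarrow> a \<noteq> v \<Longrightarrow> \<exists>z\<in>V. E u z \<and> z \<noteq> v \<and> z \<noteq> a"
    and nonleaf: "\<And>u. u \<in> V \<Longrightarrow> E v u \<Longrightarrow> \<exists>a\<in>V. E u a \<and> a \<noteq> v"
    and C: "leaf_or_pentagon (V - {x. x = w \<or> E w x}) v"
    and w: "w \<in> V" "w \<noteq> v" "\<not> E v w"
  obtains u x x' u' y y' where "fork V v w u x x'" "fork V v w u' y y'" "E x y"
    "\<not> E w u" "\<not> E w u'"
proof -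
  define V' where "V' = V - {x. x = w \<or> E w x}"
  have "\<not> (\<exists>u\<in>V'. E v u \<and> (\<forall>z\<in>V'. E u z \<longrightarrow> z = v))"
  proof
    assume "\<exists>u\<in>V'. E v u \<and> (\<forall>z\<in>V'. E u z \<longrightarrow> z = v)"
    then obtain u where u: "u \<in> V" "E v u" "\<not> E w u" "u \<noteq> w"
      and uz: "\<And>z. z \<in> V' \<Longrightarrow> E u z \<Longrightarrow> z = v" by (auto simp: V'_def)
    have uz': "z = v \<or> E w z" if "z \<in> V" "E u z" for z
      using uz[of z] that u(3) sym[of u z] by (auto simp: V'_def)
    obtain a where a: "a \<in> V" "E u a" "a \<noteq> v" using nonleaf u by blast
    obtain z where z: "z \<in> V" "E u z" "z \<noteq> v" "z \<noteq> a" using neg u a by blast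
    have "E w a" "E w z" using uz' a z by blast+
    then show False using no_square[of u z w a] a z u(4) sym by metis
  qed
  then obtain u u' x y where in_V': "u \<in> V'" "u' \<in> V'" "x \<in> V'" "y \<in> V'"
    and u: "E v u" "E u x" "x \<noteq> v" and u': "E v u'" "E u' y" "y \<noteq> v" and xy: "E x y"
    and Nu: "\<forall>z\<in>V'. E u z \<longrightarrow> z = v \<or> z = x" and Nu': "\<forall>z\<in>V'. E u' z \<longrightarrow> z = v \<or> z = y"
    using C unfolding leaf_or_pentagon_def V'_def[symmetric] by blast
  have V: "u \<in> V" "u' \<in> V" "x \<in> V" "y \<in> V"
    and nadj: "\<not> E w u" "\<not> E w u'" "\<not> E w x" "\<not> E w y" "u \<noteq> w" "u' \<noteq> w"
    using in_V' by (auto simp: V'_def)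
  have A: "z = v \<or> z = x \<or> E w z" if "z \<in> V" "E u z" for z
    using Nu that nadj(1) sym[of u w] by (auto simp: V'_def)
  have A': "z = v \<or> z = y \<or> E w z" if "z \<in> V" "E u' z" for z
    using Nu' that nadj(2) sym[of u' w] by (auto simp: V'_def)
  obtain x' where x': "fork V v w u x x'"
    using forkI[of u V v w x] V nadj u A neg[of u x] by blast
  obtain y' where y': "fork V v w u' y y'"
    using forkI[of u' V v w y] V nadj u' A' neg[of u' y] by blast
  show thesis using that x' y' xy nadj(1,2) by blast
qed

text \<open>Only \<open>u\<close> and \<open>u'\<close> carry forks for \<open>w\<close>. Applying
  \<open>forks\<close> to \<open>x\<close> and to \<open>y\<close> yields further neighbours
  \<open>g\<close> of \<open>x\<close> and \<open>h\<close> of \<open>y\<close>, nonadjacent to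
  \<open>w\<close>; then \<open>{w, g, h}\<close> dominates both \<open>A(u)\<close> and
  \<open>A(u')\<close>.\<close>

lemma no_two_forks:
  assumes V: "finite V" "wc V" "v \<in> V"
    and forks: "\<And>w. w \<in> V \<Longrightarrow> w \<noteq> v \<Longrightarrow> \<not> E v w \<Longrightarrow>
      \<exists>u x x' u' y y'. fork V v w u x x' \<and> fork V v w u' y y' \<and> E x y \<and> \<not> E w u \<and> \<not> E w u'"
    and w: "w \<in> V" "w \<noteq> v" "\<not> E v w"
  shows False
proof -
  obtain u x x' u' y y' where fx: "fork V v w u x x'" and fy: "fork V v w u' y y'" and xy: "E x y"
    and wu: "\<not> E w u" "\<not> E w u'" using forks[OF w] by blast
  note u = fx[unfolded fork_def] and u' = fy[unfolded fork_def]
  have far: "\<not> E v z" if "E p z" "E v p" for p z using no_triangle that by blast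
  have not_v: "z \<noteq> v" if "\<not> E v s" "E s z" for s z using that sym by blast
  have uu': "u \<noteq> u'" using no_triangle u u' xy by blast
  have wx: "\<not> E w x" using no_square[of u x w x'] u wu w sym by metis
  have wy: "\<not> E w y" using no_square[of u' y w y'] u' wu w sym by metis
  have far_near: "\<not> E v q" if "E p s" "E s q" "E v p" "s \<noteq> v" "q \<noteq> p" for p q s
    using no_square[of v p s q] that sym by metis
  \<comment> \<open>Otherwise let \<open>p\<close> be a neighbour of \<open>s\<close>: then \<open>{w, p}\<close> or \<open>{w, p, x}\<close> dominates \<open>A(t)\<close> and one of
      \<open>A(u)\<close> and \<open>A(u')\<close>.\<close>
  have no_third: "t = u \<or> t = u'" if f: "fork V v w t s s'" for t s s'
  proof (rule ccontr)
    assume tu: "\<not> ?thesis"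
    have t: "t \<in> V" "E v t" "t \<noteq> u" "t \<noteq> u'" "s \<in> V" "s' \<in> V" "E t s" "E t s'" "s \<noteq> v" "s' \<noteq> v"
      "s \<noteq> s'" "E w s'" and Nt: "\<And>z. z \<in> V \<Longrightarrow> E t z \<Longrightarrow> z = v \<or> z = s \<or> z = s'"
      using f tu unfolding fork_def by blast+
    have fs: "\<not> E v s" using far t by blast
    have "s \<noteq> w" using no_triangle t sym by blast
    \<comment> \<open>The two forks for \<open>s\<close> provide distinct neighbours
      \<open>x1'\<close> and \<open>y1'\<close> of \<open>s\<close>. Without squares,
      \<open>w\<close> is nonadjacent to one of them, which serves as \<open>p\<close>.\<close>
    obtain p where p: "p \<in> V" "E s p" "p \<noteq> v" "\<not> E v p" "\<not> E w p"
    proof -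
      obtain u1 x1 x1' u2 y1 y1' where f1: "fork V v s u1 x1 x1'" and f2: "fork V v s u2 y1 y1'"
        and "E x1 y1" using forks[OF t(5) t(9) fs] by blast
      then have "x1' \<noteq> y1'" using no_triangle no_square[of v u1 x1' u2] sym unfolding fork_def by metis
      moreover have "\<not> (E w x1' \<and> E w y1')"
        using no_square[of w x1' s y1'] \<open>x1' \<noteq> y1'\<close> \<open>s \<noteq> w\<close> f1 f2 sym unfolding fork_def by metis
      moreover have "\<not> E v x1'" "\<not> E v y1'" using f1 f2 far unfolding fork_def by blast+
      ultimately show thesis using that[of x1'] that[of y1'] f1 f2 unfolding fork_def by blast
    qed
    have pw: "\<not> E p w" using p sym by blast
    have dom_t: "dominates V v I t" if "w \<in> I" "p \<in> I" for I
      using Nt t(12) p(2) that sym unfolding dominates_def by blast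
    show False
    proof (cases "E p x \<or> E p y")
      case True
      then have "dominates V v {w, p} u \<or> dominates V v {w, p} u'"
        using u u' sym unfolding dominates_def by blast
      then have "t = u \<or> t = u'"
        using dominates_one[OF V, of "{w, p}" t u] dominates_one[OF V, of "{w, p}" t u']
          dom_t[of "{w, p}"] p pw w t u u' by auto
      then show False using t by blast
    next
      case False
      have "\<not> E x w" "\<not> E x p" using wx False sym by blast+
      moreover have "dominates V v {w, p, x} u'"
        using u' xy sym unfolding dominates_def by blast
      moreover have "\<not> E v x" using far u by blast
      ultimately have "t = u'"
        using dom_t[of "{w, p, x}"] p pw w t u u' wx False
        by (intro dominates_one[OF V, of "{w, p, x}"]) auto
      then show False using t by blast
    qed
  qed
  \<comment> \<open>Stated for fresh names, since it is used for \<open>x\<close> and, with the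
    roles exchanged, for \<open>y\<close>. The vertex \<open>g\<close> comes from a fork for
    \<open>x\<close>; if \<open>w\<close> were adjacent to \<open>g\<close>, this would be a fork
    for \<open>w\<close> as well, and its base would be \<open>u\<close> or
    \<open>u'\<close>.\<close>
  have extra: "\<exists>g\<in>V. E x g \<and> g \<noteq> y \<and> g \<noteq> v \<and> \<not> E v g \<and> \<not> E w g"
    if fx: "fork V v w u x x'" and fy: "fork V v w u' y y'" and xy: "E x y"
      and uu': "u \<noteq> u'" and wu: "\<not> E w u" "\<not> E w u'" 
      and no_third: "\<And>t s s'. fork V v w t s s' \<Longrightarrow> t = u \<or> t = u'"
    for u x x' u' y y'
  proof -
    note u = fx[unfolded fork_def] and u' = fy[unfolded fork_def]
    have fx: "\<not> E v x" using far u by blast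
    have "x \<in> V" "x \<noteq> v" using u by blast+
    obtain u1 x1 x1' u2 y1 y1' where f1: "fork V v x u1 x1 x1'" and f2: "fork V v x u2 y1 y1'"
      and "E x1 y1" using forks[OF \<open>x \<in> V\<close> \<open>x \<noteq> v\<close> fx] by blast
    then have "x1' \<noteq> y1'" using no_triangle no_square[of v u1 x1' u2] sym unfolding fork_def by metis
    then obtain t s g where f: "fork V v x t s g" and "g \<noteq> y" using f1 f2 by metis
    note t = f[unfolded fork_def]
    have "t \<noteq> u" using t u no_triangle by blast
    moreover have "g \<noteq> y'" using no_square[of x y u' y'] t u' fx xy sym by metis
    then have "t \<noteq> u'" using t u' \<open>g \<noteq> y\<close> by blast
    ultimately have "\<not> E w g" using no_third[of t s g] t unfolding fork_def by blast
    then show ?thesis using t far \<open>g \<noteq> y\<close> by blast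
  qed
  have "\<exists>g\<in>V. E x g \<and> g \<noteq> y \<and> g \<noteq> v \<and> \<not> E v g \<and> \<not> E w g"
    by (rule extra[OF fx fy xy uu' wu]) (rule no_third)
  then obtain g where g: "g \<in> V" "E x g" "g \<noteq> y" "g \<noteq> v" "\<not> E v g" "\<not> E w g" by auto
  have "\<exists>h\<in>V. E y h \<and> h \<noteq> x \<and> h \<noteq> v \<and> \<not> E v h \<and> \<not> E w h"
    by (rule extra[OF fy fx sym[OF xy] uu'[symmetric] wu(2,1)]) (drule no_third, erule disj_commute[THEN iffD1])
  then obtain h where h: "h \<in> V" "E y h" "h \<noteq> x" "h \<noteq> v" "\<not> E v h" "\<not> E w h" by auto
  have "\<not> E g h" using no_square[of x g h y] g h xy sym by metis
  moreover have "dominates V v {w, g, h} u" "dominates V v {w, g, h} u'"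
    using u u' g h sym unfolding dominates_def by blast+
  moreover have "\<not> E g w" "\<not> E h w" "\<not> E h g" using g h sym \<open>\<not> E g h\<close> by blast+
  ultimately have "u = u'"
    using u u' g h w by (intro dominates_one[OF V, of "{w, g, h}"]) auto
  then show False using uu' by blast
qed

section \<open>Characterisation of shedding vertices\<close>

text \<open>In a minimal counterexample every \<open>A(u)\<close> has two vertices by
  \<open>no_singleton\<close>; then \<open>fork_pair\<close> provides the forks that
  \<open>no_two_forks\<close> refutes.\<close>

theorem shed_imp_leaf_or_pentagon:
  assumes "finite V" "wc V" "v \<in> V" "shed V v"
  shows "leaf_or_pentagon V v"
  using assms
proof (induction V rule: finite_psubset_induct)
  case (psubset V)
  have IH: "leaf_or_pentagon (V - {x. x = w \<or> E w x}) v" if "w \<in> V" "w \<noteq> v" "\<not> E v w" for w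
    using psubset.IH[of "V - {x. x = w \<or> E w x}"] psubset.prems psubset.hyps that wc_delete[of V w]
      shed_delete[of V v w] sym by blast
  show ?case
  proof (rule ccontr)
    assume neg: "\<not> ?thesis"
    have nonleaf: "\<exists>a\<in>V. E u a \<and> a \<noteq> v" if "u \<in> V" "E v u" for u
      using neg that unfolding leaf_or_pentagon_def by blast
    have two: "\<exists>z\<in>V. E u z \<and> z \<noteq> v \<and> z \<noteq> a"
      if "u \<in> V" "E v u" "a \<in> V" "E u a" "a \<noteq> v" for u a
      using no_singleton[OF psubset.hyps psubset.prems(1,2) neg IH that] by blast
    have forks: "\<exists>u x x' u' y y'. fork V v w u x x' \<and> fork V v w u' y y' \<and> E x y \<and> \<not> E w u \<and> \<not> E w u'"
      if "w \<in> V" "w \<noteq> v" "\<not> E v w" for w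
      by (rule fork_pair[OF _ _ IH[OF that] that], erule (4) two, erule (1) nonleaf, blast)
    \<comment> \<open>The empty set yields a neighbour \<open>u\<close> of \<open>v\<close>; a
      vertex of \<open>A(u)\<close> is then the \<open>w\<close> needed for
      \<open>no_two_forks\<close>.\<close>
    have "indep (insert v {})" by simp
    then obtain u where u: "u \<in> V" "E v u"
      using psubset.prems(3) unfolding shed_def by blast
    then obtain a where "a \<in> V" "E u a" "a \<noteq> v" using nonleaf by blast
    then show False
      using no_two_forks[OF psubset.hyps psubset.prems(1,2) forks] u no_triangle by blast
  qed
qed

text \<open>By symmetry \<open>x\<close> may be the vertex of degree 2, so that \<open>y\<close> is
  determined by \<open>u\<close>. For the converse, an independent \<open>S\<close> cannot contain
  both \<open>x\<close> and \<open>y\<close>, so \<open>u\<close> or \<open>u'\<close> can be added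
  to it.\<close>

theorem shed_iff:
  assumes V: "finite V" "wc V" "v \<in> V" and closed: "\<And>x y. E x y \<Longrightarrow> y \<in> V"
  shows "shed V v \<longleftrightarrow> (\<exists>u. E v u \<and> Collect (E u) = {v}) \<or>
    (\<exists>u u' x y. E v u \<and> E v u' \<and> Collect (E u) = {v, x} \<and> x \<noteq> v \<and> Collect (E x) = {u, y} \<and> y \<noteq> u \<and>
       Collect (E u') = {v, y} \<and> y \<noteq> v)" (is "_ \<longleftrightarrow> ?leaf \<or> ?pentagon")
proof
  assume "shed V v"
  then have C: "leaf_or_pentagon V v" by (rule shed_imp_leaf_or_pentagon[OF V])
  show "?leaf \<or> ?pentagon"
  proof (rule disjCI)
    assume not_pentagon: "\<not> ?pentagon"
    have False if "u \<in> V" "u' \<in> V" "x \<in> V" "y \<in> V" and u: "E v u" "E v u'" "E u x" "E u' y" and xy: "E x y"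
      and v: "x \<noteq> v" "y \<noteq> v" and Nu: "\<And>z. z \<in> V \<Longrightarrow> E u z \<Longrightarrow> z = v \<or> z = x"
      and Nu': "\<And>z. z \<in> V \<Longrightarrow> E u' z \<Longrightarrow> z = v \<or> z = y" for u u' x y
    proof -
      have Cu: "Collect (E u) = {v, x}" "Collect (E u') = {v, y}"
        using Nu[OF closed] Nu'[OF closed] u(3,4) sym[OF u(1)] sym[OF u(2)] by blast+
      have neq: "y \<noteq> u" "x \<noteq> u'"
        using no_triangle[OF u(1,3)] no_triangle[OF u(2,4)] u(1,2) xy sym v no_triangle[OF sym[OF u(3)] sym[OF u(1)]] by metis+
      have "Collect (E x) \<noteq> {u, y}" using not_pentagon u(1,2) Cu v neq by metis
      then obtain p where p: "E x p" "p \<noteq> u" "p \<noteq> y" using sym[OF u(3)] xy by blast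
      have "Collect (E y) \<noteq> {u', x}" using not_pentagon u(1,2) Cu v neq by metis
      then obtain q where q: "E y q" "q \<noteq> u'" "q \<noteq> x" using sym[OF u(4)] sym[OF xy] by blast
      have "\<not> E p q" using no_square[of p x y q] p q xy sym by metis
      moreover have "\<not> E q p" using \<open>\<not> E p q\<close> sym by blast
      moreover have "\<not> E v p" "\<not> E v q"
        using no_square[of v u x p] no_square[of v u' y q] u p q v sym by metis+
      moreover have "p \<noteq> v" "q \<noteq> v"
        using no_triangle[OF u(1,3)] no_triangle[OF u(2,4)] p(1) q(1) sym by blast+
      moreover have "dominates V v {p, q} u" "dominates V v {p, q} u'"
        using Nu Nu' p(1) q(1) unfolding dominates_def by blast+
      ultimately have "u = u'"
        using u p q closed that(1,2) by (intro dominates_one[OF V, of "{p, q}"]) auto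
      then show False using no_triangle u(3,4) xy by blast
    qed
    then obtain u where u: "E v u" "\<forall>z\<in>V. E u z \<longrightarrow> z = v"
      using C unfolding leaf_or_pentagon_def by metis
    then have "Collect (E u) = {v}" using closed sym[OF u(1)] by blast
    then show ?leaf using \<open>E v u\<close> by blast
  qed
next
  assume R: "?leaf \<or> ?pentagon"
  show "shed V v" unfolding shed_def
  proof (intro allI impI)
    fix S assume S: "S \<subseteq> V \<and> v \<notin> S \<and> indep (insert v S)"
    have ok: "\<exists>u\<in>V. E v u \<and> indep (insert u S)" if "E v u" "\<And>s. s \<in> S \<Longrightarrow> \<not> E u s" for u
      using that S closed by (intro bexI[of _ u]) auto
    from R show "\<exists>u\<in>V. E v u \<and> indep (insert u S)"
    proof
      assume ?leaf
      then obtain u where u: "E v u" "Collect (E u) = {v}" by blast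
      then have "s = v" if "E u s" for s using that by auto
      then show ?thesis using ok[OF u(1)] S by blast
    next
      assume ?pentagon
      then obtain u x y u' where u: "E v u" "E v u'" "Collect (E u) = {v, x}" "Collect (E x) = {u, y}"
        "Collect (E u') = {v, y}" by blast
      have N: "E u s \<longleftrightarrow> s = v \<or> s = x" "E u' s \<longleftrightarrow> s = v \<or> s = y" "E x s \<longleftrightarrow> s = u \<or> s = y" for s
        using u(3-5) by (simp_all add: set_eq_iff)
      then have "E x y" by blast
      then have "x \<notin> S \<or> y \<notin> S" using S by (auto simp: indep_def)
      moreover have "s \<noteq> v" if "s \<in> S" for s using S that by blast
      ultimately have "(\<forall>s\<in>S. \<not> E u s) \<or> (\<forall>s\<in>S. \<not> E u' s)"
        unfolding N(1,2) by (elim disjE) auto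
      then show ?thesis using ok[OF u(1)] ok[OF u(2)] by blast
    qed
  qed
qed

end

section \<open>Transfer to graphs of girth at least 5\<close>

lemma girth5_graph_parcs:
  assumes "pair_graph G" "5 \<le> girth G"
  shows "girth5_graph (\<lambda>x y. (x, y) \<in> parcs G)"
proof -
  interpret pair_graph G by fact
  have wf: "x \<in> pverts G" "y \<in> pverts G" if "(x, y) \<in> parcs G" for x y
    using in_arcsD1 in_arcsD2 that by auto
  have no_cycle: False if "pre_digraph.cycle (with_proj G) p" "3 \<le> length p" "length p < 5" for p
  proof -
    have "girth G \<le> enat (length p)" unfolding girth_def using that by (intro INF_lower) auto
    then have "enat 5 \<le> enat (length p)" using assms(2) by (metis order_trans numeral_eq_enat)
    then show False using that(3) by simp
  qed
  have neq: "x \<noteq> y" if "(x, y) \<in> parcs G" for x y using no_loops[of "(x, y)"] that by auto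
  show ?thesis
  proof
    show "(y, x) \<in> parcs G" if "(x, y) \<in> parcs G" for x y
      using that arcs_symmetric by blast
    show "(x, x) \<notin> parcs G" for x using neq by blast
    show "(x, z) \<notin> parcs G" if "(x, y) \<in> parcs G" "(y, z) \<in> parcs G" for x y z
    proof
      assume xz: "(x, z) \<in> parcs G"
      then have zx: "(z, x) \<in> parcs G" using arcs_symmetric by blast
      have "cycle [(x, y), (y, z), (z, x)]"
        unfolding cycle_def awalk_def
        using that zx wf neq[OF that(1)] neq[OF that(2)] neq[OF zx]
        by (auto intro!: exI[of _ x])
      then show False using no_cycle by fastforce
    qed
    show "a = b \<or> x = y"
      if "(a, x) \<in> parcs G" "(x, b) \<in> parcs G" "(b, y) \<in> parcs G" "(y, a) \<in> parcs G" for a x b y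
    proof (rule ccontr)
      assume "\<not> ?thesis"
      then have "cycle [(a, x), (x, b), (b, y), (y, a)]"
        unfolding cycle_def awalk_def
        using that wf neq[OF that(1)] neq[OF that(2)] neq[OF that(3)] neq[OF that(4)]
        by (auto intro!: exI[of _ a])
      then show False using no_cycle by fastforce
    qed
  qed
qed

text \<open>This is \<open>shed_iff\<close> for \<open>V = pverts G\<close>, after matching the two
  formulations of independence, well-coveredness and shedding.\<close>

theorem shedding_iff:
  assumes "pair_graph G" "5 \<le> girth G" "well_covered G" "v \<in> pverts G"
  shows "shedding G v \<longleftrightarrow> (\<exists>u. u \<in> nbh G v \<and> nbh G u = {v}) \<or>
    (\<exists>u u' x y. u \<in> nbh G v \<and> u' \<in> nbh G v \<and> nbh G u = {v, x} \<and> x \<noteq> v \<and> nbh G x = {u, y} \<and> y \<noteq> u \<and>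
      nbh G u' = {v, y} \<and> y \<noteq> v)"
proof -
  interpret pair_graph G by fact
  interpret girth5_graph "\<lambda>x y. (x, y) \<in> parcs G" by (rule girth5_graph_parcs[OF assms(1,2)])
  have wf: "x \<in> pverts G" "y \<in> pverts G" if "(x, y) \<in> parcs G" for x y
    using in_arcsD1 in_arcsD2 that by auto
  have ind: "indep_set G S \<longleftrightarrow> S \<subseteq> pverts G \<and> indep S" for S
    by (auto simp: indep_set_def indep_def)
  have "maximal_indep_set G S" if S: "maxind (pverts G) S" for S
    unfolding maximal_indep_set_def ind
  proof (intro conjI notI)
    show "S \<subseteq> pverts G" "indep S" using S by (auto simp: maxind_def)
    assume "\<exists>S'. (S' \<subseteq> pverts G \<and> indep S') \<and> S \<subset> S'"
    then obtain S' x where "S' \<subseteq> pverts G" "indep S'" "S \<subseteq> S'" "x \<in> S' - S" by blast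
    then show False using S unfolding maxind_def indep_def by blast
  qed
  then have "wc (pverts G)"
    using assms(3) by (auto simp: wc_def well_covered_def)
  moreover have "shedding G v \<longleftrightarrow> shed (pverts G) v"
  proof -
    have "S \<subseteq> pverts G - closed_nbh G v \<and> indep_set G S \<longleftrightarrow> S \<subseteq> pverts G \<and> v \<notin> S \<and> indep (insert v S)" for S
      by (auto simp: closed_nbh_def nbh_def ind)
    moreover have "(\<exists>u\<in>nbh G v. indep_set G (S \<union> {u})) \<longleftrightarrow>
      (\<exists>u\<in>pverts G. (v, u) \<in> parcs G \<and> indep (insert u S))" if "S \<subseteq> pverts G" for S
      using that wf by (auto simp: nbh_def ind)
    ultimately show ?thesis unfolding shedding_def shed_def by (metis (no_types, lifting))
  qed
  ultimately show ?thesis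
    using shed_iff[of "pverts G" v] assms(4) finite_verts wf(2) by (simp add: nbh_def)
qed

section \<open>Running programs\<close>

definition bounded :: "nat \<Rightarrow> (nat \<Rightarrow> nat) \<Rightarrow> bool" where
  "bounded w f \<longleftrightarrow> (\<forall>i. f i \<le> w)"

lemma bounded_upd: "bounded w f \<Longrightarrow> x \<le> w \<Longrightarrow> bounded w (f(i := x))"
  by (simp add: bounded_def)

lemma bounded_zero: "bounded w (\<lambda>_. 0)"
  by (simp add: bounded_def)

text \<open>A timed judgement for program fragments. It records the bound \<open>w\<close> for every
  configuration on the way, since \<open>decides_within\<close> demands it at all times.\<close>

definition reaches :: "instr list \<Rightarrow> nat list \<Rightarrow> nat \<Rightarrow> (config \<Rightarrow> bool) \<Rightarrow> nat \<Rightarrow> config \<Rightarrow> bool" where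
  "reaches P inp w Q t c \<longleftrightarrow> (\<exists>k\<le>t. Q ((step P inp ^^ k) c) \<and>
     (\<forall>j\<le>k. bounded w (regs ((step P inp ^^ j) c)) \<and> bounded w (mem ((step P inp ^^ j) c))))"

lemma reaches_stop: "Q c \<Longrightarrow> bounded w (regs c) \<Longrightarrow> bounded w (mem c) \<Longrightarrow> reaches P inp w Q t c"
  unfolding reaches_def by (intro exI[of _ 0]) simp

lemma reaches_trans:
  assumes "reaches P inp w Q s c" "\<And>c'. Q c' \<Longrightarrow> reaches P inp w R t c'"
  shows "reaches P inp w R (s + t) c"
proof -
  let ?f = "\<lambda>k. step P inp ^^ k"
  obtain k where k: "k \<le> s" "Q (?f k c)"
    and kb: "\<And>j. j \<le> k \<Longrightarrow> bounded w (regs (?f j c)) \<and> bounded w (mem (?f j c))"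
    using assms(1) unfolding reaches_def by blast
  obtain l where l: "l \<le> t" "R (?f l (?f k c))"
    and lb: "\<And>j. j \<le> l \<Longrightarrow> bounded w (regs (?f j (?f k c))) \<and> bounded w (mem (?f j (?f k c)))"
    using assms(2)[OF k(2)] unfolding reaches_def by blast
  have eq: "?f j (?f k c) = ?f (j + k) c" for j by (simp add: funpow_add)
  have "bounded w (regs (?f j c)) \<and> bounded w (mem (?f j c))" if "j \<le> l + k" for j
  proof (cases "j \<le> k")
    case False
    then show ?thesis using lb[of "j - k"] that by (simp add: eq)
  qed (use kb in simp)
  then show ?thesis unfolding reaches_def
    using k(1) l(1,2) by (intro exI[of _ "l + k"]) (simp add: eq)
qed

text \<open>The configuration is given by its fields and the side conditions are one conjunction, so
  that repeated use with simplification executes straight-line code symbolically.\<close>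

lemma reaches_step:
  assumes "0 < t \<and> l < length P \<and> bounded w r \<and> bounded w m"
    "reaches P inp w Q (t - 1) (exec inp (P ! l) \<lparr>pc = l, regs = r, mem = m\<rparr>)"
  shows "reaches P inp w Q t \<lparr>pc = l, regs = r, mem = m\<rparr>"
proof -
  let ?c = "\<lparr>pc = l, regs = r, mem = m\<rparr>"
  have "reaches P inp w (\<lambda>c. c = exec inp (P ! l) ?c) 1 ?c"
    unfolding reaches_def
  proof (intro exI[of _ 1] conjI allI impI)
    show s: "(step P inp ^^ 1) ?c = exec inp (P ! l) ?c"
      using assms(1) by (simp add: step_def halted_def)
    have b: "bounded w (regs (exec inp (P ! l) ?c)) \<and> bounded w (mem (exec inp (P ! l) ?c))"
      using assms(2) unfolding reaches_def by (metis funpow_0 le0)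
    fix j :: nat assume "j \<le> 1"
    then consider "j = 0" | "j = 1" by linarith
    then have "bounded w (regs ((step P inp ^^ j) ?c)) \<and> bounded w (mem ((step P inp ^^ j) ?c))"
      by cases (use s b assms(1) in auto)
    then show "bounded w (regs ((step P inp ^^ j) ?c))" "bounded w (mem ((step P inp ^^ j) ?c))"
      by auto
  qed simp
  then have "reaches P inp w Q (1 + (t - 1)) ?c" by (rule reaches_trans) (use assms(2) in simp)
  then show ?thesis using assms(1) by simp
qed

lemma reaches_mono:
  assumes "reaches P inp w Q s c" "s \<le> t" "\<And>c. Q c \<Longrightarrow> R c"
  shows "reaches P inp w R t c"
  using assms unfolding reaches_def by (meson order_trans)

text \<open>A halted configuration is a fixed point of \<open>step\<close>, so the bounds up to
  halting hold forever.\<close>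

lemma reaches_decides:
  assumes "reaches P inp w (\<lambda>c. halted P c \<and> regs c 0 = of_bool b) t init_config"
  shows "decides_within P inp b t w"
proof -
  obtain k where k: "k \<le> t" "halted P (run P inp k)" "regs (run P inp k) 0 = of_bool b"
    and bd: "\<And>j. j \<le> k \<Longrightarrow> bounded w (regs (run P inp j)) \<and> bounded w (mem (run P inp j))"
    using assms unfolding reaches_def run_def by blast
  have stay: "run P inp (k + j) = run P inp k" for j
    by (induction j) (use k(2) in \<open>simp_all add: run_def step_def\<close>)
  have "bounded w (regs (run P inp j)) \<and> bounded w (mem (run P inp j))" for j
    using bd[of j] bd[of k] stay[of "j - k"] by (cases "j \<le> k") auto
  then show ?thesis unfolding decides_within_def bounded_def using k by auto
qed

definition cell :: "nat list \<Rightarrow> nat \<Rightarrow> nat" where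
  "cell inp i = (if i < length inp then inp ! i else 0)"

lemma exec_Input: "exec inp (Input r s) c = set_reg r (cell inp (regs c s)) c"
  by (simp add: cell_def)

section \<open>The program\<close>

text \<open>
  Registers 2 and 3 hold the constants 1 and 2, register 4 holds \<open>v\<close>, registers 5 and 6 the bounds of
  its adjacency list, register 7 the position in that list, register 9 the current neighbour \<open>u\<close>, and
  register 16 the number of completed passes.  Register 0 stays 0 until acceptance, so
  \<open>JumpZ 0\<close> is an unconditional jump.  A nonzero memory cell is a mark.  Two passes are needed
  because a mark may be set only after it has been tested.  The second neighbour of a
  vertex of degree 2 is the sum of its two list entries minus the known neighbour.
  Degrees are compared with 1 and 2 by decrementing twice, because truncated subtraction of 2
  would not tell degree 1 from degree 2.
\<close>

definition prog :: "instr list" where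
  "prog =
    [Const 2 1, Const 3 2, Input 4 2,
     Add 10 4 3, Input 5 10, Add 10 10 2, Input 6 10,
     \<comment> \<open>7: a pass over the neighbours of \<open>v\<close>\<close>
     Add 7 5 0,
     Sub 8 6 7, JumpZ 8 47,
     Input 9 7,
     Add 10 9 3, Input 11 10, Add 10 10 2, Input 12 10, Sub 12 12 11,
     Sub 12 12 2, JumpZ 12 51, Sub 12 12 2, JumpZ 12 21, JumpZ 0 45,
     \<comment> \<open>21: \<open>u\<close> has degree 2; mark its other neighbour \<open>x\<close>\<close>
     Input 13 11, Add 11 11 2, Input 14 11, Add 13 13 14, Sub 13 13 4, Store 13 2,
     Add 10 13 3, Input 11 10, Add 10 10 2, Input 12 10, Sub 12 12 11,
     Sub 12 12 2, JumpZ 12 45, Sub 12 12 2, JumpZ 12 37, JumpZ 0 45,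
     \<comment> \<open>37: \<open>x\<close> has degree 2; test whether its other neighbour is marked\<close>
     Input 13 11, Add 11 11 2, Input 14 11, Add 13 13 14, Sub 13 13 9,
     Load 15 13, JumpZ 15 45, JumpZ 0 51,
     \<comment> \<open>45: next neighbour\<close>
     Add 7 7 2, JumpZ 0 8,
     \<comment> \<open>47: end of a pass\<close>
     Sub 8 2 16, JumpZ 8 52, Const 16 1, JumpZ 0 7,
     \<comment> \<open>51: accept\<close>
     Const 0 1]"

lemma length_prog: "length prog = 52"
  by (simp add: prog_def)

lemma prog_nth:
  "prog ! 0 = Const 2 1" "prog ! Suc 0 = Const 3 2" "prog ! 2 = Input 4 2" "prog ! 3 = Add 10 4 3"
  "prog ! 4 = Input 5 10" "prog ! 5 = Add 10 10 2" "prog ! 6 = Input 6 10" "prog ! 7 = Add 7 5 0"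
  "prog ! 8 = Sub 8 6 7" "prog ! 9 = JumpZ 8 47" "prog ! 10 = Input 9 7" "prog ! 11 = Add 10 9 3"
  "prog ! 12 = Input 11 10" "prog ! 13 = Add 10 10 2" "prog ! 14 = Input 12 10"
  "prog ! 15 = Sub 12 12 11" "prog ! 16 = Sub 12 12 2" "prog ! 17 = JumpZ 12 51"
  "prog ! 18 = Sub 12 12 2" "prog ! 19 = JumpZ 12 21" "prog ! 20 = JumpZ 0 45"
  "prog ! 21 = Input 13 11" "prog ! 22 = Add 11 11 2" "prog ! 23 = Input 14 11"
  "prog ! 24 = Add 13 13 14" "prog ! 25 = Sub 13 13 4" "prog ! 26 = Store 13 2"
  "prog ! 27 = Add 10 13 3" "prog ! 28 = Input 11 10" "prog ! 29 = Add 10 10 2"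
  "prog ! 30 = Input 12 10" "prog ! 31 = Sub 12 12 11" "prog ! 32 = Sub 12 12 2"
  "prog ! 33 = JumpZ 12 45" "prog ! 34 = Sub 12 12 2" "prog ! 35 = JumpZ 12 37"
  "prog ! 36 = JumpZ 0 45" "prog ! 37 = Input 13 11" "prog ! 38 = Add 11 11 2"
  "prog ! 39 = Input 14 11" "prog ! 40 = Add 13 13 14" "prog ! 41 = Sub 13 13 9"
  "prog ! 42 = Load 15 13" "prog ! 43 = JumpZ 15 45" "prog ! 44 = JumpZ 0 51"
  "prog ! 45 = Add 7 7 2" "prog ! 46 = JumpZ 0 8" "prog ! 47 = Sub 8 2 16"
  "prog ! 48 = JumpZ 8 52" "prog ! 49 = Const 16 1" "prog ! 50 = JumpZ 0 7" "prog ! 51 = Const 0 1"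
  by (simp_all add: prog_def)

declare exec.simps [simp del]

text \<open>The equation for \<open>Input\<close> is replaced by \<open>exec_Input\<close>, which
  hides the bounds check in \<open>cell\<close>. Folding \<open>Suc (Suc 0)\<close> makes
  incremented program counters match \<open>prog_nth\<close>.\<close>

lemmas prog_exec = exec.simps(1-3,5-7) exec_Input set_reg_def prog_nth numeral_2_eq_2[symmetric]

section \<open>Correctness and running time\<close>

text \<open>The bound in \<open>width\<close> leaves room for the sum of two vertex numbers and for
  addresses shifted by a small constant.\<close>

locale adjacency_input =
  fixes L :: "nat list list" and v w :: nat
  assumes v_less: "v < length L"
    and nth_less: "u < length L \<Longrightarrow> x \<in> set (L ! u) \<Longrightarrow> x < length L"
    and nth_sym: "u < length L \<Longrightarrow> x \<in> set (L ! u) \<Longrightarrow> u \<in> set (L ! x)"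
    and nth_irrefl: "u < length L \<Longrightarrow> u \<notin> set (L ! u)"
    and nth_distinct: "u < length L \<Longrightarrow> distinct (L ! u)"
    and width: "2 * length (encode_input L v) + 5 \<le> w"
begin

abbreviation "inp \<equiv> encode_input L v"

section \<open>Layout of the input word\<close>

definition start :: "nat \<Rightarrow> nat" where
  "start u = length L + 3 + (\<Sum>x<u. length (L ! x))"

definition deg :: "nat \<Rightarrow> nat" where
  "deg u = length (L ! u)"

lemma length_concat_take: "length (concat (take u L)) = (\<Sum>x<u. length (L ! x))" if "u \<le> length L"
  using that by (induction u) (simp_all add: take_Suc_conv_app_nth)

lemma length_inp: "length inp = length L + 3 + (\<Sum>x<length L. length (L ! x))"
  using length_concat_take[of "length L"] by (simp add: encode_input_def Let_def)

lemma start_Suc: "start (Suc u) = start u + deg u"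
  by (simp add: start_def deg_def)

lemma start_mono: "u \<le> u' \<Longrightarrow> start u \<le> start u'"
  unfolding start_def by (intro add_left_mono sum_mono2) auto

lemma start_le: "u < length L \<Longrightarrow> start u + deg u \<le> length inp"
  using start_mono[of "Suc u" "length L"] by (simp add: start_Suc length_inp) (simp add: start_def)

lemma cell_v: "cell inp (Suc 0) = v"
  by (simp add: cell_def encode_input_def Let_def)

lemma cell_start: "u \<le> length L \<Longrightarrow> cell inp (Suc (Suc u)) = start u"
  by (simp add: cell_def encode_input_def Let_def nth_append start_def del: upt_Suc)

lemma cell_end: "u < length L \<Longrightarrow> cell inp (Suc (Suc (Suc u))) = start u + deg u"
  using cell_start[of "Suc u"] by (simp add: start_Suc)

lemma cell_nth:
  assumes u: "u < length L" and j: "j < deg u"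
  shows "cell inp (start u + j) = L ! u ! j"
proof -
  have "concat L = concat (take u L) @ L ! u @ concat (drop (Suc u) L)"
    using u by (metis id_take_nth_drop concat.simps(2) concat_append)
  then have "concat L ! ((\<Sum>x<u. length (L ! x)) + j) = L ! u ! j"
    using u j length_concat_take[of u] by (simp add: nth_append deg_def)
  moreover have "start u + j < length inp" using start_le[OF u] j by simp
  moreover have "inp = (length L # v # map start [0..<length L + 1]) @ concat L"
    by (simp add: encode_input_def Let_def start_def)
  ultimately show ?thesis
    by (simp add: cell_def start_def nth_append del: upt_Suc)
qed

section \<open>Symbolic execution of the program\<close>

definition frame :: "nat \<Rightarrow> nat \<Rightarrow> (nat \<Rightarrow> nat) \<Rightarrow> bool" where
  "frame p b r \<longleftrightarrow> bounded w r \<and> r 0 = 0 \<and> r 2 = Suc 0 \<and> r 3 = 2 \<and> r 4 = v \<and> r 5 = start v \<and>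
     r 6 = start v + deg v \<and> r 7 = p \<and> r 16 = b"

abbreviation reach :: "(config \<Rightarrow> bool) \<Rightarrow> nat \<Rightarrow> config \<Rightarrow> bool" where
  "reach \<equiv> reaches prog inp w"

definition at_pc :: "nat \<Rightarrow> ((nat \<Rightarrow> nat) \<Rightarrow> bool) \<Rightarrow> (nat \<Rightarrow> nat) \<Rightarrow> config \<Rightarrow> bool" where
  "at_pc l F m c \<longleftrightarrow> pc c = l \<and> F (regs c) \<and> mem c = m"

lemma reach_seq:
  assumes "reach (at_pc l F m) s c" "\<And>r. F r \<Longrightarrow> reach Q t \<lparr>pc = l, regs = r, mem = m\<rparr>" "s + t \<le> T"
  shows "reach Q T c"
proof -
  have "reach Q t c'" if "at_pc l F m c'" for c'
    using that assms(2)[of "regs c'"] unfolding at_pc_def by (cases c') auto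
  then have "reach Q (s + t) c" by (rule reaches_trans[OF assms(1)])
  then show ?thesis using assms(3) reaches_mono by blast
qed

lemma width_facts:
  "Suc (Suc (Suc (length L))) \<le> length inp" "2 * length inp + 5 \<le> w"
  using width by (simp_all add: length_inp)

definition other :: "nat \<Rightarrow> nat \<Rightarrow> nat" where
  "other a b = L ! b ! 0 + L ! b ! Suc 0 - a"

definition halts_with :: "nat \<Rightarrow> config \<Rightarrow> bool" where
  "halts_with x c \<longleftrightarrow> halted prog c \<and> regs c 0 = x"

lemma nth_nth_less: "u < length L \<Longrightarrow> i < deg u \<Longrightarrow> L ! u ! i < length L"
  using nth_less by (simp add: deg_def)

lemma reach_setup:
  "reach (at_pc 7 (frame 0 0) (\<lambda>_. 0)) 7 init_config"
  unfolding init_config_def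
  by (insert v_less start_le[OF v_less] width_facts cell_v cell_start[of v] cell_end[OF v_less], simp,
      ((rule reaches_step, simp add: length_prog bounded_upd bounded_zero, simp add: prog_exec)+,
      rule reaches_stop, simp_all add: at_pc_def frame_def bounded_upd bounded_zero))

lemma reach_start_pass:
  assumes "frame p b r" "bounded w m"
  shows "reach (at_pc 8 (frame (start v) b) m) 1 \<lparr>pc = 7, regs = r, mem = m\<rparr>"
  by (insert assms(1)[unfolded frame_def] assms(2) start_le[OF v_less] width_facts,
      ((rule reaches_step, simp add: length_prog bounded_upd bounded_zero, simp add: prog_exec)+,
      rule reaches_stop, simp_all add: at_pc_def frame_def bounded_upd bounded_zero))

lemma reach_degree:
  assumes "frame (start v + i) b r" "bounded w m" "i < deg v" and u: "L ! v ! i = u"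
  shows "reach (at_pc (if deg u \<le> 1 then 51 else if deg u = 2 then 21 else 45)
    (\<lambda>r. frame (start v + i) b r \<and> r 9 = u \<and> r 11 = start u) m) 13 \<lparr>pc = 8, regs = r, mem = m\<rparr>"
proof -
  have u_less: "u < length L" using nth_nth_less[OF v_less assms(3)] u by simp
  note facts = assms(1)[unfolded frame_def] assms(2,3) v_less start_le[OF v_less] width_facts u_less
    cell_nth[OF v_less assms(3)] u start_le[OF u_less] cell_start[of u] cell_end[OF u_less]
  let ?at = "\<lambda>l. at_pc l (\<lambda>r. frame (start v + i) b r \<and> r 9 = u \<and> r 11 = start u) m"
  consider "deg u \<le> 1" | "1 < deg u" "deg u \<le> 2" | "2 < deg u" by linarith
  then show ?thesis
  proof cases
    case 1
    have "reach (?at 51) 10 \<lparr>pc = 8, regs = r, mem = m\<rparr>"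
      by (insert facts 1, ((rule reaches_step, simp add: length_prog bounded_upd bounded_zero, simp add: prog_exec)+,
      rule reaches_stop, simp_all add: at_pc_def frame_def bounded_upd bounded_zero))
    then show ?thesis by (rule reaches_mono) (use 1 in auto)
  next
    case 2
    have "reach (?at 21) 12 \<lparr>pc = 8, regs = r, mem = m\<rparr>"
      by (insert facts 2, ((rule reaches_step, simp add: length_prog bounded_upd bounded_zero, simp add: prog_exec)+,
      rule reaches_stop, simp_all add: at_pc_def frame_def bounded_upd bounded_zero))
    then show ?thesis by (rule reaches_mono) (use 2 in auto)
  next
    case 3
    have "reach (?at 45) 13 \<lparr>pc = 8, regs = r, mem = m\<rparr>"
      by (insert facts 3, ((rule reaches_step, simp add: length_prog bounded_upd bounded_zero, simp add: prog_exec)+,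
      rule reaches_stop, simp_all add: at_pc_def frame_def bounded_upd bounded_zero))
    then show ?thesis by (rule reaches_mono) (use 3 in auto)
  qed
qed

lemma reach_mark:
  assumes "frame p b r" "r 9 = u" "r 11 = start u" "bounded w m" "u < length L" "deg u = 2"
  shows "reach (at_pc 27 (\<lambda>r. frame p b r \<and> r 9 = u \<and> r 13 = other v u) (m(other v u := 1))) 6
    \<lparr>pc = 21, regs = r, mem = m\<rparr>"
  unfolding other_def
  by (insert assms(1)[unfolded frame_def] assms(2-5) width_facts start_le[OF assms(5)] assms(6)
       cell_nth[of u 0] cell_nth[of u 1] nth_nth_less[of u 0] nth_nth_less[of u 1], simp,
      ((rule reaches_step, simp add: length_prog bounded_upd bounded_zero, simp add: prog_exec)+,
      rule reaches_stop, simp_all add: at_pc_def frame_def bounded_upd bounded_zero))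

lemma reach_second_degree:
  assumes "frame p b r" "r 9 = u" "r 13 = x" "bounded w m" "x < length L"
  shows "reach (at_pc (if deg x = 2 then 37 else 45)
    (\<lambda>r. frame p b r \<and> r 9 = u \<and> r 11 = start x) m) 10 \<lparr>pc = 27, regs = r, mem = m\<rparr>"
proof -
  note facts = assms(1)[unfolded frame_def] assms(2-5) width_facts
    start_le[OF assms(5)] cell_start[of x] cell_end[OF assms(5)]
  let ?at = "\<lambda>l. at_pc l (\<lambda>r. frame p b r \<and> r 9 = u \<and> r 11 = start x) m"
  consider "deg x \<le> 1" | "1 < deg x" "deg x \<le> 2" | "2 < deg x" by linarith
  then show ?thesis
  proof cases
    case 1
    have "reach (?at 45) 7 \<lparr>pc = 27, regs = r, mem = m\<rparr>"
      by (insert facts 1, ((rule reaches_step, simp add: length_prog bounded_upd bounded_zero, simp add: prog_exec)+,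
      rule reaches_stop, simp_all add: at_pc_def frame_def bounded_upd bounded_zero))
    then show ?thesis by (rule reaches_mono) (use 1 in auto)
  next
    case 2
    have "reach (?at 37) 9 \<lparr>pc = 27, regs = r, mem = m\<rparr>"
      by (insert facts 2, ((rule reaches_step, simp add: length_prog bounded_upd bounded_zero, simp add: prog_exec)+,
      rule reaches_stop, simp_all add: at_pc_def frame_def bounded_upd bounded_zero))
    then show ?thesis by (rule reaches_mono) (use 2 in auto)
  next
    case 3
    have "reach (?at 45) 10 \<lparr>pc = 27, regs = r, mem = m\<rparr>"
      by (insert facts 3, ((rule reaches_step, simp add: length_prog bounded_upd bounded_zero, simp add: prog_exec)+,
      rule reaches_stop, simp_all add: at_pc_def frame_def bounded_upd bounded_zero))
    then show ?thesis by (rule reaches_mono) (use 3 in auto)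
  qed
qed

lemma reach_test:
  assumes "frame p b r" "r 9 = u" "r 11 = start x" "bounded w m" "x < length L" "deg x = 2"
  shows "reach (at_pc (if m (other u x) = 0 then 45 else 51) (frame p b) m) 8
    \<lparr>pc = 37, regs = r, mem = m\<rparr>"
proof -
  note facts = assms(1)[unfolded frame_def] assms(2-5) width_facts start_le[OF assms(5)] assms(6)
    cell_nth[of x 0] cell_nth[of x 1] nth_nth_less[of x 0] nth_nth_less[of x 1]
    assms(4)[unfolded bounded_def, rule_format, of "other u x", unfolded other_def]
  show ?thesis
  proof (cases "m (other u x) = 0")
    case True
    have "reach (at_pc 45 (frame p b) m) 7 \<lparr>pc = 37, regs = r, mem = m\<rparr>"
      by (insert facts True[unfolded other_def], simp, ((rule reaches_step, simp add: length_prog bounded_upd bounded_zero, simp add: prog_exec)+,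
      rule reaches_stop, simp_all add: at_pc_def frame_def bounded_upd bounded_zero))
    then show ?thesis by (rule reaches_mono) (use True in auto)
  next
    case False
    have "reach (at_pc 51 (frame p b) m) 8 \<lparr>pc = 37, regs = r, mem = m\<rparr>"
      by (insert facts False[unfolded other_def], simp, ((rule reaches_step, simp add: length_prog bounded_upd bounded_zero, simp add: prog_exec)+,
      rule reaches_stop, simp_all add: at_pc_def frame_def bounded_upd bounded_zero))
    then show ?thesis by (rule reaches_mono) (use False in auto)
  qed
qed

lemma reach_next:
  assumes "frame p b r" "bounded w m" "p \<le> length inp"
  shows "reach (at_pc 8 (frame (Suc p) b) m) 2 \<lparr>pc = 45, regs = r, mem = m\<rparr>"
  by (insert assms(1)[unfolded frame_def] assms(2,3) width_facts,
      ((rule reaches_step, simp add: length_prog bounded_upd bounded_zero, simp add: prog_exec)+,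
      rule reaches_stop, simp_all add: at_pc_def frame_def bounded_upd bounded_zero))

lemma reach_accept:
  assumes "frame p b r" "bounded w m"
  shows "reach (halts_with 1) 1 \<lparr>pc = 51, regs = r, mem = m\<rparr>"
  by (insert assms(1)[unfolded frame_def] assms(2) width_facts,
      ((rule reaches_step, simp add: length_prog bounded_upd bounded_zero, simp add: prog_exec)+,
      rule reaches_stop, simp_all add: at_pc_def frame_def bounded_upd bounded_zero halts_with_def halted_def length_prog))

lemma reach_end_pass:
  assumes "frame (start v + deg v) b r" "bounded w m"
  shows "reach (at_pc 47 (frame (start v + deg v) b) m) 2 \<lparr>pc = 8, regs = r, mem = m\<rparr>"
  by (insert assms(1)[unfolded frame_def] assms(2) width_facts,
      ((rule reaches_step, simp add: length_prog bounded_upd bounded_zero, simp add: prog_exec)+,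
      rule reaches_stop, simp_all add: at_pc_def frame_def bounded_upd bounded_zero))

lemma reach_second_pass:
  assumes "frame p 0 r" "bounded w m"
  shows "reach (at_pc 7 (frame p 1) m) 4 \<lparr>pc = 47, regs = r, mem = m\<rparr>"
  by (insert assms(1)[unfolded frame_def] assms(2) width_facts,
      ((rule reaches_step, simp add: length_prog bounded_upd bounded_zero, simp add: prog_exec)+,
      rule reaches_stop, simp_all add: at_pc_def frame_def bounded_upd bounded_zero))

lemma reach_reject:
  assumes "frame p 1 r" "bounded w m"
  shows "reach (halts_with 0) 2 \<lparr>pc = 47, regs = r, mem = m\<rparr>"
  by (insert assms(1)[unfolded frame_def] assms(2) width_facts,
      ((rule reaches_step, simp add: length_prog bounded_upd bounded_zero, simp add: prog_exec)+,
      rule reaches_stop, simp_all add: at_pc_def frame_def bounded_upd bounded_zero halts_with_def halted_def length_prog))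

lemma other_eq:
  assumes "b < length L" "deg b = 2" "a \<in> set (L ! b)"
  shows "set (L ! b) = {a, other a b}" "other a b \<noteq> a"
proof -
  obtain p q where pq: "L ! b = [p, q]" "p \<noteq> q"
    using assms(2) nth_distinct[OF assms(1)] unfolding deg_def
    by (auto simp: length_Suc_conv numeral_2_eq_2)
  then show "set (L ! b) = {a, other a b}" "other a b \<noteq> a"
    using assms(3) by (auto simp: other_def)
qed

section \<open>Functional model of a pass and running time\<close>

definition mark :: "(nat \<Rightarrow> nat) \<Rightarrow> nat \<Rightarrow> nat \<Rightarrow> nat" where
  "mark m u = (if deg u = 2 then m(other v u := 1) else m)"

definition hit :: "(nat \<Rightarrow> nat) \<Rightarrow> nat \<Rightarrow> bool" where
  "hit m u \<longleftrightarrow> deg u \<le> 1 \<or> deg u = 2 \<and> deg (other v u) = 2 \<and> m (other u (other v u)) \<noteq> 0"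

text \<open>\<open>None\<close> stands for acceptance, \<open>Some m\<close> for reaching the end of
  the list with marks \<open>m\<close>. As in the program, \<open>u\<close> sets its mark before it
  is tested.\<close>

fun scan :: "nat list \<Rightarrow> (nat \<Rightarrow> nat) \<Rightarrow> (nat \<Rightarrow> nat) option" where
  "scan [] m = Some m"
| "scan (u # us) m = (if hit (mark m u) u then None else scan us (mark m u))"

lemma bounded_mark: "bounded w m \<Longrightarrow> bounded w (mark m u)"
  using width by (auto simp: mark_def intro: bounded_upd)

lemma bounded_scan: "bounded w m \<Longrightarrow> scan us m = Some m' \<Longrightarrow> bounded w m'"
  by (induction us arbitrary: m) (auto split: if_splits dest: bounded_mark)

text \<open>The longest path takes 13 + 6 + 10 + 8 + 2 = 39 steps.\<close>

lemma reach_neighbour: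
  assumes r: "frame (start v + i) b r" and m: "bounded w m" and i: "i < deg v" and u: "L ! v ! i = u"
  shows "reach (if hit (mark m u) u then halts_with 1
      else at_pc 8 (frame (start v + Suc i) b) (mark m u)) 40 \<lparr>pc = 8, regs = r, mem = m\<rparr>"
    (is "reach ?Q 40 ?c")
proof -
  let ?p = "start v + i"
  have u_less: "u < length L" using nth_nth_less[OF v_less i] u by simp
  have vu: "v \<in> set (L ! u)" using nth_sym[OF v_less, of u] i u by (auto simp: deg_def)
  have next': "reach (at_pc 8 (frame (start v + Suc i) b) m') 2 \<lparr>pc = 45, regs = r', mem = m'\<rparr>"
    if "frame ?p b r'" "bounded w m'" for r' m'
    using reach_next[OF that] i start_le[OF v_less] by simp
  consider "deg u \<le> 1" | "deg u = 2" | "deg u > 2" by linarith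
  then show ?thesis
  proof cases
    case 1
    then have Q: "?Q = halts_with 1" by (simp add: hit_def)
    show ?thesis unfolding Q
      by (rule reach_seq[OF reach_degree[OF r m i u, unfolded if_P[OF 1]]], erule conjE,
          erule reach_accept[OF _ m]) simp
  next
    case 3
    then have Q: "?Q = at_pc 8 (frame (start v + Suc i) b) m" and d: "\<not> deg u \<le> 1" "deg u \<noteq> 2"
      by (simp_all add: hit_def mark_def)
    show ?thesis unfolding Q
      by (rule reach_seq[OF reach_degree[OF r m i u, unfolded if_not_P[OF d(1)] if_not_P[OF d(2)]]],
          erule conjE, erule next'[OF _ m]) simp
  next
    case 2
    then have d: "\<not> deg u \<le> 1" by simp
    define x where "x = other v u"
    define m1 where "m1 = m(x := 1)"
    have mark: "mark m u = m1" by (simp add: mark_def m1_def x_def 2)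
    have m1: "bounded w m1" using bounded_mark[OF m, of u] mark by simp
    have x: "x \<in> set (L ! u)" using other_eq[OF u_less 2 vu] by (simp add: x_def)
    then have x_less: "x < length L" using nth_less u_less by blast
    have ux: "u \<in> set (L ! x)" using nth_sym u_less x by blast
    note degree = reach_degree[OF r m i u, unfolded if_not_P[OF d] if_P[OF 2]]
    have second: "reach (at_pc (if deg x = 2 then 37 else 45)
        (\<lambda>r. frame ?p b r \<and> r 9 = u \<and> r 11 = start x) m1) 29 ?c"
    proof (rule reach_seq[OF degree])
      fix r' assume "frame ?p b r' \<and> r' 9 = u \<and> r' 11 = start u"
      then have r': "frame ?p b r'" "r' 9 = u" "r' 11 = start u" by blast+
      show "reach (at_pc (if deg x = 2 then 37 else 45)
        (\<lambda>r. frame ?p b r \<and> r 9 = u \<and> r 11 = start x) m1) 16 \<lparr>pc = 21, regs = r', mem = m\<rparr>"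
        by (rule reach_seq[OF reach_mark[OF r' m u_less 2, folded x_def, folded m1_def]],
            elim conjE, erule (1) reach_second_degree[OF _ _ _ m1 x_less], assumption) simp
    qed simp
    show ?thesis
    proof (cases "deg x = 2")
      case False
      then have Q: "?Q = at_pc 8 (frame (start v + Suc i) b) m1"
        using 2 by (simp add: hit_def mark flip: x_def)
      show ?thesis unfolding Q
        by (rule reach_seq[OF second[unfolded if_not_P[OF False]]],
            erule conjE, erule next'[OF _ m1]) simp
    next
      case True
      have test: "reach (at_pc (if m1 (other u x) = 0 then 45 else 51) (frame ?p b) m1) 37 ?c"
        by (rule reach_seq[OF second[unfolded if_P[OF True]]], elim conjE,
            erule (2) reach_test[OF _ _ _ m1 x_less True]) simp
      show ?thesis
      proof (cases "m1 (other u x) = 0")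
        case T: True
        then have Q: "?Q = at_pc 8 (frame (start v + Suc i) b) m1"
          using 2 by (simp add: hit_def mark flip: x_def)
        show ?thesis unfolding Q
          by (rule reach_seq[OF test[unfolded if_P[OF T]]], erule next'[OF _ m1]) simp
      next
        case F: False
        then have Q: "?Q = halts_with 1"
          using 2 True by (simp add: hit_def mark flip: x_def)
        show ?thesis unfolding Q
          by (rule reach_seq[OF test[unfolded if_not_P[OF F]]], erule reach_accept[OF _ m1]) simp
      qed
    qed
  qed
qed

text \<open>Induction from the end of the list towards its front; the 2 extra steps detect the
  end.\<close>

lemma reach_pass:
  assumes "frame (start v + i) b r" "bounded w m" "i \<le> deg v"
  shows "reach (case scan (drop i (L ! v)) m of None \<Rightarrow> halts_with 1
      | Some m' \<Rightarrow> at_pc 47 (frame (start v + deg v) b) m') (40 * (deg v - i) + 2) \<lparr>pc = 8, regs = r, mem = m\<rparr>"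
  using assms(3,1,2)
proof (induction i arbitrary: r m rule: inc_induct)
  case base
  then show ?case using reach_end_pass by (simp add: deg_def numeral_2_eq_2)
next
  case (step i)
  have drop: "drop i (L ! v) = L ! v ! i # drop (Suc i) (L ! v)"
    using step.hyps by (simp add: deg_def Cons_nth_drop_Suc)
  note neighbour = reach_neighbour[OF step.prems step.hyps(2) refl]
  show ?case
  proof (cases "hit (mark m (L ! v ! i)) (L ! v ! i)")
    case True
    show ?thesis using neighbour step.hyps(2) by (auto simp: drop True elim!: reaches_mono)
  next
    case False
    then have "scan (drop i (L ! v)) m = scan (drop (Suc i) (L ! v)) (mark m (L ! v ! i))"
      by (simp add: drop)
    then show ?thesis
      using step.hyps(2)
      by (simp only:) (rule reach_seq[OF neighbour[unfolded if_not_P[OF False]]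
        step.IH[OF _ bounded_mark[OF step.prems(2)]]], simp_all)
  qed
qed

definition accepts :: bool where
  "accepts \<longleftrightarrow> (case scan (L ! v) (\<lambda>_. 0) of None \<Rightarrow> True | Some m \<Rightarrow> scan (L ! v) m = None)"

text \<open>Each pass takes at most \<open>40 * deg v + 3\<close> steps; setup, change of pass and
  rejection add 7 + 4 + 2.\<close>

lemma reach_answer: "reach (halts_with (of_bool accepts)) (80 * deg v + 20) init_config"
proof -
  have zero: "bounded w (\<lambda>_. 0)" by (simp add: bounded_zero)
  have pass: "reach (case scan (L ! v) m of None \<Rightarrow> halts_with 1
      | Some m' \<Rightarrow> at_pc 47 (frame (start v + deg v) b) m') (40 * deg v + 3) \<lparr>pc = 7, regs = r, mem = m\<rparr>"
    if "frame p b r" "bounded w m" for p b r m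
  proof (rule reach_seq[OF reach_start_pass[OF that]])
    fix r' assume "frame (start v) b r'"
    then show "reach (case scan (L ! v) m of None \<Rightarrow> halts_with 1
      | Some m' \<Rightarrow> at_pc 47 (frame (start v + deg v) b) m') (40 * deg v + 2) \<lparr>pc = 8, regs = r', mem = m\<rparr>"
      using reach_pass[of 0 b r' m] that(2) by simp
  qed simp
  have "reach (halts_with (of_bool accepts)) (80 * deg v + 13) \<lparr>pc = 7, regs = r, mem = \<lambda>_. 0\<rparr>"
    if r: "frame 0 0 r" for r
  proof (cases "scan (L ! v) (\<lambda>_. 0)")
    case None
    then show ?thesis using pass[OF r zero] by (auto simp: accepts_def elim!: reaches_mono)
  next
    case (Some m)
    then have m: "bounded w m" using bounded_scan zero by blast
    show ?thesis
    proof (rule reach_seq[OF pass[OF r zero, unfolded Some option.case]])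
      fix r1 assume "frame (start v + deg v) 0 r1"
      then show "reach (halts_with (of_bool accepts)) (40 * deg v + 10) \<lparr>pc = 47, regs = r1, mem = m\<rparr>"
      proof (rule reach_seq[OF reach_second_pass[OF _ m]])
        fix r2 assume r2: "frame (start v + deg v) 1 r2"
        show "reach (halts_with (of_bool accepts)) (40 * deg v + 6) \<lparr>pc = 7, regs = r2, mem = m\<rparr>"
        proof (cases "scan (L ! v) m")
          case None
          then show ?thesis using pass[OF r2 m] Some by (auto simp: accepts_def elim!: reaches_mono)
        next
          case (Some m')
          have "accepts = False"
            using \<open>scan (L ! v) (\<lambda>_. 0) = _\<close> Some by (simp add: accepts_def)
          then show ?thesis
            using bounded_scan[OF m Some]
            by (simp, intro reach_seq[OF pass[OF r2 m, unfolded Some option.case] reach_reject]) auto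
        qed
      qed simp
    qed simp
  qed
  then show ?thesis by (rule reach_seq[OF reach_setup]) simp_all
qed

section \<open>Correctness of the marks\<close>

definition criterion :: bool where
  "criterion \<longleftrightarrow> (\<exists>u\<in>set (L ! v). deg u \<le> 1 \<or> deg u = 2 \<and> deg (other v u) = 2 \<and>
     (\<exists>u'\<in>set (L ! v). deg u' = 2 \<and> other v u' = other u (other v u)))"

definition sound :: "(nat \<Rightarrow> nat) \<Rightarrow> bool" where
  "sound m \<longleftrightarrow> (\<forall>a. m a \<noteq> 0 \<longrightarrow> (\<exists>u\<in>set (L ! v). deg u = 2 \<and> other v u = a))"

lemma sound_mark: "sound m \<Longrightarrow> u \<in> set (L ! v) \<Longrightarrow> sound (mark m u)"
  by (auto simp: sound_def mark_def)

lemma hit_sound: "sound m \<Longrightarrow> u \<in> set (L ! v) \<Longrightarrow> hit m u \<Longrightarrow> criterion"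
  unfolding hit_def criterion_def sound_def by blast

lemma scan_sound:
  assumes "sound m" "set us \<subseteq> set (L ! v)"
  shows "case scan us m of None \<Rightarrow> criterion | Some m' \<Rightarrow> sound m'"
  using assms by (induction us arbitrary: m) (auto simp: sound_mark dest: hit_sound[rotated 2])

text \<open>Marks are never erased and a hit persists when marks are added, so a pass that does not
  accept has no hit even for the initial marks.\<close>

lemma scan_complete:
  assumes "scan us m = Some m'"
  shows "(\<forall>a. m a \<noteq> 0 \<longrightarrow> m' a \<noteq> 0) \<and>
    (\<forall>u\<in>set us. \<not> hit m u \<and> (deg u = 2 \<longrightarrow> m' (other v u) \<noteq> 0))"
  using assms
proof (induction us arbitrary: m)
  case (Cons u us)
  have mono: "m a \<noteq> 0 \<Longrightarrow> mark m u a \<noteq> 0" for a by (simp add: mark_def)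
  then have hit: "hit m x \<Longrightarrow> hit (mark m u) x" for x unfolding hit_def by blast
  have u: "deg u = 2 \<Longrightarrow> mark m u (other v u) \<noteq> 0" by (simp add: mark_def)
  have "\<not> hit (mark m u) u" "scan us (mark m u) = Some m'" using Cons.prems by (auto split: if_splits)
  then show ?case using Cons.IH[of "mark m u"] mono hit u by (simp, blast)
qed simp

lemma accepts_iff: "accepts \<longleftrightarrow> criterion"
proof (cases "scan (L ! v) (\<lambda>_. 0)")
  case None
  then show ?thesis using scan_sound[of "\<lambda>_. 0" "L ! v"] by (simp add: accepts_def sound_def)
next
  case (Some m)
  have m: "sound m" using scan_sound[of "\<lambda>_. 0" "L ! v"] Some by (simp add: sound_def)
  show ?thesis
  proof (cases "scan (L ! v) m")
    case None
    then show ?thesis using scan_sound[OF m, of "L ! v"] Some by (simp add: accepts_def)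
  next
    case S: (Some m')
    \<comment> \<open>After the first pass every neighbour of degree 2 has set its mark, so the
      second pass would hit any \<open>u\<close> that meets the criterion.\<close>
    have "\<not> criterion"
      using scan_complete[OF Some] scan_complete[OF S] unfolding criterion_def hit_def by metis
    then show ?thesis using S Some by (simp add: accepts_def)
  qed
qed

theorem prog_decides: "decides_within prog inp criterion (80 * deg v + 20) w"
  using reach_answer by (intro reaches_decides) (simp add: accepts_iff halts_with_def[abs_def])

end

section \<open>Word size and the shedding property\<close>

text \<open>Each adjacency list has at most n entries, so the input has at most n^2 + n + 3 words
  and a quadratic bound suffices.\<close>

lemma adjacency_inputI:
  assumes "pair_graph G" "adjacency_lists G L" "v \<in> pverts G"
    and w: "2 * ((length L)\<^sup>2 + length L + 3) + 5 \<le> w"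
  shows "adjacency_input L v w"
proof -
  interpret pair_graph G by fact
  have V: "pverts G = {..<length L}"
    and L: "\<And>u. u < length L \<Longrightarrow> distinct (L ! u)" "\<And>u. u < length L \<Longrightarrow> set (L ! u) = nbh G u"
    using assms(2) by (auto simp: adjacency_lists_def)
  have nbh: "x < length L" "u \<in> nbh G x" if "x \<in> nbh G u" for u x
    using in_arcsD2 arcs_symmetric that V by (auto simp: nbh_def)
  have irrefl: "u \<notin> nbh G u" for u
    using no_loops[of "(u, u)"] by (auto simp: nbh_def)
  have "length (L ! u) \<le> length L" if "u < length L" for u
  proof -
    have "length (L ! u) = card (nbh G u)" using L that by (metis distinct_card)
    also have "\<dots> \<le> card {..<length L}" using nbh(1) by (intro card_mono) auto
    finally show ?thesis by simp
  qed
  then have "(\<Sum>u<length L. length (L ! u)) \<le> (length L)\<^sup>2"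
    using sum_bounded_above[of "{..<length L}" "\<lambda>u. length (L ! u)" "length L"]
    by (simp add: power2_eq_square)
  moreover have "length (concat L) = (\<Sum>u<length L. length (L ! u))"
    by (simp add: length_concat sum_list_sum_nth atLeast0LessThan)
  ultimately have "length (encode_input L v) \<le> (length L)\<^sup>2 + length L + 3"
    by (simp add: encode_input_def Let_def)
  then have "2 * length (encode_input L v) + 5 \<le> 2 * ((length L)\<^sup>2 + length L + 3) + 5"
    by (intro add_right_mono mult_left_mono) simp_all
  also note w
  finally have "2 * length (encode_input L v) + 5 \<le> w" .
  then show ?thesis
    using assms(3) V L nbh irrefl by unfold_locales auto
qed

context adjacency_input
begin

text \<open>\<open>deg2\<close> and \<open>deg2I\<close> translate between lists of length 2 and
  neighbourhoods with two vertices. In \<open>deg1\<close>, degree at most 1 means a leaf because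
  \<open>v\<close> is a neighbour of \<open>u\<close>.\<close>

lemma criterion_iff_shedding:
  assumes G: "pair_graph G" "5 \<le> girth G" "well_covered G" "adjacency_lists G L"
  shows "criterion \<longleftrightarrow> shedding G v"
proof -
  have V: "v \<in> pverts G" and N: "set (L ! u) = nbh G u" if "u < length L" for u
    using G(4) v_less that by (auto simp: adjacency_lists_def)
  have deg: "deg u = card (nbh G u)" if "u < length L" for u
    using N[OF that] nth_distinct[OF that] by (simp add: deg_def flip: distinct_card)
  have mem: "x < length L" "u \<in> nbh G x" if "u < length L" "x \<in> nbh G u" for u x
  proof -
    have x: "x \<in> set (L ! u)" using N[OF that(1)] that(2) by simp
    show "x < length L" using nth_less[OF that(1) x] .
    then show "u \<in> nbh G x" using nth_sym[OF that(1) x] N by simp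
  qed
  have deg2: "nbh G b = {a, other a b} \<and> other a b \<noteq> a" if "deg b = 2" "b < length L" "a \<in> nbh G b" for a b
    using other_eq[OF that(2,1)] N[OF that(2)] that(3) by simp
  have deg2I: "deg b = 2 \<and> other a b = c" if "nbh G b = {a, c}" "c \<noteq> a" "b < length L" for a b c
  proof
    show "deg b = 2" using deg[OF that(3)] that(1,2) by simp
    then show "other a b = c" using deg2[of b a] that by (simp add: doubleton_eq_iff)
  qed
  have deg1: "deg u \<le> 1 \<longleftrightarrow> nbh G u = {v}" if "u \<in> nbh G v" for u
  proof -
    note u = mem[OF v_less that]
    show ?thesis
    proof
    assume "deg u \<le> 1"
    moreover have "finite (nbh G u)" using N[OF u(1)] by (metis List.finite_set)
    ultimately show "nbh G u = {v}"
      using u(2) deg[OF u(1)] by (auto simp: card_le_Suc0_iff_eq)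
    qed (simp add: deg[OF u(1)])
  qed
  show ?thesis
    unfolding shedding_iff[OF G(1-3) V[OF v_less]] criterion_def N[OF v_less]
  proof
    assume "\<exists>u\<in>nbh G v. deg u \<le> 1 \<or> deg u = 2 \<and> deg (other v u) = 2 \<and>
      (\<exists>u'\<in>nbh G v. deg u' = 2 \<and> other v u' = other u (other v u))"
    then obtain u where u: "u \<in> nbh G v" and disj: "deg u \<le> 1 \<or> deg u = 2 \<and> deg (other v u) = 2 \<and>
      (\<exists>u'\<in>nbh G v. deg u' = 2 \<and> other v u' = other u (other v u))" by blast
    note mem_u = mem[OF v_less u]
    from disj show "(\<exists>u. u \<in> nbh G v \<and> nbh G u = {v}) \<or>
      (\<exists>u u' x y. u \<in> nbh G v \<and> u' \<in> nbh G v \<and> nbh G u = {v, x} \<and> x \<noteq> v \<and>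
        nbh G x = {u, y} \<and> y \<noteq> u \<and> nbh G u' = {v, y} \<and> y \<noteq> v)"
    proof (elim disjE conjE bexE)
      assume "deg u \<le> 1"
      then show ?thesis using deg1 u by blast
    next
      fix u' assume d: "deg u = 2" "deg (other v u) = 2" "u' \<in> nbh G v" "deg u' = 2"
        and y: "other v u' = other u (other v u)"
      define x where "x = other v u"
      have x: "nbh G u = {v, x}" "x \<noteq> v" using deg2[OF d(1) mem_u] by (simp_all add: x_def)
      then have "x < length L" "u \<in> nbh G x" using mem[OF mem_u(1), of x] by auto
      then have "nbh G x = {u, other u x}" "other u x \<noteq> u" using deg2[of x u] d(2) by (simp_all add: x_def)
      moreover have "nbh G u' = {v, other u x}" "other u x \<noteq> v"
        using deg2[OF d(4) mem[OF v_less d(3)]] y by (simp_all add: x_def)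
      ultimately show ?thesis using u d(3) x by blast
    qed
  next
    assume "(\<exists>u. u \<in> nbh G v \<and> nbh G u = {v}) \<or>
      (\<exists>u u' x y. u \<in> nbh G v \<and> u' \<in> nbh G v \<and> nbh G u = {v, x} \<and> x \<noteq> v \<and>
        nbh G x = {u, y} \<and> y \<noteq> u \<and> nbh G u' = {v, y} \<and> y \<noteq> v)"
    then show "\<exists>u\<in>nbh G v. deg u \<le> 1 \<or> deg u = 2 \<and> deg (other v u) = 2 \<and>
      (\<exists>u'\<in>nbh G v. deg u' = 2 \<and> other v u' = other u (other v u))"
    proof (elim disjE exE conjE)
      fix u assume "u \<in> nbh G v" "nbh G u = {v}"
      then show ?thesis using deg1 by blast
    next
      fix u u' x y
      assume u: "u \<in> nbh G v" "u' \<in> nbh G v" and N': "nbh G u = {v, x}" "x \<noteq> v" "nbh G x = {u, y}"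
        "y \<noteq> u" "nbh G u' = {v, y}" "y \<noteq> v"
      have "x < length L" using mem(1)[OF mem(1)[OF v_less u(1)], of x] N' by simp
      then have "deg x = 2 \<and> other u x = y" using deg2I N' by blast
      moreover have "deg u = 2 \<and> other v u = x" "deg u' = 2 \<and> other v u' = y"
        using deg2I mem(1)[OF v_less] u N' by blast+
      ultimately show ?thesis using u by (intro bexI[of _ u] disjI2) auto
    qed
  qed
qed

end

theorem theorem6p3:
  shows "\<exists>(P :: instr list) (T :: nat \<Rightarrow> nat) (W :: nat \<Rightarrow> nat) (d :: nat).
    (\<lambda>n. real (T n)) \<in> O(\<lambda>n. real n) \<and>
    (\<lambda>n. real (W n)) \<in> O(\<lambda>n. real n ^ d) \<and>
    (\<forall>(G :: nat pair_pre_digraph) (n :: nat) (L :: nat list list) (v :: nat).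
       pair_graph G \<and> Digraph_Component.connected (with_proj G) \<and> well_covered G \<and>
       5 \<le> girth G \<and> card (pverts G) = n \<and> adjacency_lists G L \<and> v \<in> pverts G \<longrightarrow>
       decides_within P (encode_input L v) (shedding G v) (T n) (W n))"
proof (intro exI conjI allI impI; (elim conjE)?)
  show "(\<lambda>n. real (80 * n + 20)) \<in> O(\<lambda>n. real n)"
    by (intro bigoI[of _ 100] eventually_sequentiallyI[of 1]) simp
  have "real (2 * (n\<^sup>2 + n + 3) + 5) \<le> 15 * real n ^ 2" if "1 \<le> n" for n
  proof -
    have "n \<le> n\<^sup>2" "1 \<le> n\<^sup>2" using that by (simp_all add: power2_eq_square)
    then have "2 * (n\<^sup>2 + n + 3) + 5 \<le> 15 * n\<^sup>2" by (simp add: distrib_left)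
    then show ?thesis by (metis of_nat_le_iff of_nat_mult of_nat_numeral of_nat_power)
  qed
  then show "(\<lambda>n. real (2 * (n\<^sup>2 + n + 3) + 5)) \<in> O(\<lambda>n. real n ^ 2)"
    by (intro bigoI[of _ 15] eventually_sequentiallyI[of 1]) simp
  fix G :: "nat pair_pre_digraph" and n v :: nat and L :: "nat list list"
  assume G: "pair_graph G" "well_covered G" "5 \<le> girth G" "adjacency_lists G L" "v \<in> pverts G"
    and n: "card (pverts G) = n"
  have n: "length L = n" using G(4) n by (simp add: adjacency_lists_def)
  interpret adjacency_input L v "2 * (n\<^sup>2 + n + 3) + 5"
    by (rule adjacency_inputI[OF G(1,4,5)]) (simp add: n)
  \<comment> \<open>Time depends on the degree of \<open>v\<close> alone, which is at most
    \<open>n\<close> however many edges there are.\<close>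
  have "deg v = card (set (L ! v))" using nth_distinct[OF v_less] by (simp add: deg_def distinct_card)
  also have "\<dots> \<le> card {..<length L}" using nth_less[OF v_less] by (intro card_mono) auto
  finally have "80 * deg v + 20 \<le> 80 * n + 20" using n by simp
  then show "decides_within prog (encode_input L v) (shedding G v) (80 * n + 20) (2 * (n\<^sup>2 + n + 3) + 5)"
    using prog_decides criterion_iff_shedding[OF G(1,3,2,4)]
    unfolding decides_within_def by (meson order_trans)
qed

end
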